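(* Let $\Omega,\Omega'$ be domains in $\mathfrak{H}$, let $J\subset\mathbb{R}$ and $U\subset\mathbb{R}^2$ be open sets, with $|U|=\mathrm{Area}(U)$ finite and positive, and let $\Phi:U\times J\to\Omega$, $((u,v),\tau)\mapsto\Phi(u,v,\tau)$, be a diffeomorphism which foliates $\Omega$ so that: (1) for every $\tau\in J$ the surface patch $\sigma_\tau:U\to\Omega$, $\sigma_\tau(u,v)=\Phi(u,v,\tau)$, is regular; (2) for every $\tau\in J$ the horizontal normal $N^h_{\sigma_\tau}$ is non-zero a.e.; (3) there is a measure $\mu$ on $J$ such that $d\mathcal{L}^3(\Phi(u,v,\tau))=\|N^h_{\sigma_\tau}(u,v)\|^{4/3}\,du\,dv\,d\mu(\tau)$. Let $\Sigma_0=\{\sigma_\tau\;|\;\tau\in J\}$ and let $\rho_0$ be the function equal to $(|U|\cdot\|N^h_{\sigma_\tau}(u,v)\|)^{-1}$ at $p=\sigma_\tau(u,v)$ (where $N^h_{\sigma_\tau}(u,v)\ne0$) and $0$ elsewhere. Let $f_0:\Omega\to\Omega'$ be a $\mathcal{C}^2$ contact orientation-preserving quasiconformal diffeomorphism which has the minimal stretching property for every surface of $\Sigma_0$ and whose distortion function satisfies $K_{f_0}(\sigma_\tau(u,v))=K_{f_0}(\tau)$ for all $((u,v),\tau)\in U\times J$, i.e. it depends only on $\tau$. Let $\Sigma\supseteq\Sigma_0$ be a family of $\mathcal{C}^2$ regular surfaces in $\Omega$ such that $\rho_0\in\mathrm{Adm}(\Sigma)$, and consider the class $\mathcal{F}'$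 of all $\mathcal{C}^2$ contact orientation-preserving quasiconformal transformations $f:\Omega\to\Omega'$ which satisfy $$\mathrm{Mod}(f_0(\Sigma_0))\le\mathrm{Mod}(f(\Sigma)).$$ Then for all $f\in\mathcal{F}'$ we have $$\mathfrak{M}_{2/3}(f_0,\rho_0)\le\mathfrak{M}_{2/3}(f,\rho_0).$$
   Context: The Heisenberg group $\mathfrak{H}$ is $\mathbb{C}\times\mathbb{R}$ (points $(z,t)$, $z=x+iy$) with contact form $\omega=dt+2x\,dy-2y\,dx$. Let $X=\partial_x+2y\,\partial_t$, $Y=\partial_y-2x\,\partial_t$, $T=\partial_t$, $Z=\frac12(X-iY)$, $\overline{Z}=\frac12(X+iY)$. The horizontal plane at $p$ is the span of $X_p,Y_p$, with the norm $\|\cdot\|$ making $X,Y$ orthonormal. A contact transformation is a diffeomorphism $f=(f_I,f_3):\Omega\to\Omega'$ between domains of $\mathfrak{H}$ ($f_I=f_1+if_2$) with $f^*\omega=\lambda\omega$, $\lambda$ non-vanishing; orientation-preserving means $\lambda>0$, and then $\lambda=|Zf_I|^2-|\overline{Z}f_I|^2=J_f^{1/2}$ ($J_f$ the Jacobian determinant). For $f$ of class $\mathcal{C}^2$ put $K_f(p)=\frac{|Zf_I(p)|+|\overline{Z}f_I(p)|}{|Zf_I(p)|-|\overline{Z}f_I(p)|}$ (distortion function); $f$ is quasiconformal iff $\mathrm{ess\,sup}_pK_f(p)<\infty$. A regular surface in $\mathfrak{H}$ is a $\mathcal{C}^2$ regular oriented surface in $\mathbb{R}^3$ in the Euclidean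 sense. For a patch $\sigma(u,v)=(x,y,t)(u,v)$ the horizontal normal is $$N^h_\sigma=\left(\tfrac{\partial(y,t)}{\partial(u,v)}+2y\tfrac{\partial(x,y)}{\partial(u,v)}\right)X+\left(\tfrac{\partial(t,x)}{\partial(u,v)}-2x\tfrac{\partial(x,y)}{\partial(u,v)}\right)Y.$$ A point is non-characteristic if $N^h_\sigma\ne0$ there. The horizontal area integral $\iint_{\mathcal S}\rho\,d\mathcal{S}^h$ of a function $\rho$ on a surface $\mathcal S$ is the integral against the parametrisation-independent area element $d\mathcal{S}^h=\|N^h_\sigma(u,v)\|\,du\,dv$. A $\mathcal{C}^2$ orientation-preserving contact quasiconformal $f$ has the minimal stretching property (mSP) for $\mathcal S$ if, in patches $\sigma$ of $\mathcal S$ and $f\circ\sigma$ of $f(\mathcal S)$, at non-characteristic points, $\|N^h_{f\circ\sigma}\|=\lambda(|Zf_I|-|\overline{Z}f_I|)\|N^h_\sigma\|$. For a family $\Sigma$ of regular surfaces, $\mathrm{Adm}(\Sigma)$ is the set of non-negative Borel functions $\rho$ on $\mathfrak{H}$ with $\iint_{\mathcal S}\rho\,d\mathcal{S}^h\ge1$ for all $\mathcal S\in\Sigma$, and $\mathrm{Mod}(\Sigma)=\inf_{\rho\in\mathrm{Adm}(\Sigma)}\iiint_{\mathfrak H}\rho^{4/3}\,d\mathcal{L}^3$, $\mathcal{L}^3$ being Lebesgue measure. For a map $f$, $f(\Sigma)=\{f(\mathcal S):\mathcal S\in\Sigma\}$. Condition (3) means that $\iiint_\Omega g\,d\mathcal{L}^3=\int_J\iint_U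 g(\Phi(u,v,\tau))\|N^h_{\sigma_\tau}(u,v)\|^{4/3}\,du\,dv\,d\mu(\tau)$ for all non-negative Borel $g$ on $\Omega$. The $2/3$-mean distortion is $\mathfrak{M}_{2/3}(f,\rho_0)=\dfrac{\iiint_\Omega K_f^{2/3}\rho_0^{4/3}\,d\mathcal{L}^3}{\iiint_\Omega \rho_0^{4/3}\,d\mathcal{L}^3}$, the denominator being understood to be positive and finite. *)

theory Defs
  imports "HOL-Probability.Essential_Supremum"
begin

text \<open>
  The Heisenberg group is identified with \<open>\<real>\<^sup>3\<close>: a point \<open>p = (x + i y, t)\<close> has coordinates
  \<open>x = p $ 1\<close>, \<open>y = p $ 2\<close>, \<open>t = p $ 3\<close>. Tangent vectors are given by their Euclidean coordinates.
\<close>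

type_synonym heis = "real^3"

definition domain :: "heis set \<Rightarrow> bool" where
  "domain \<Omega> \<longleftrightarrow> open \<Omega> \<and> connected \<Omega> \<and> \<Omega> \<noteq> {}"


subsection \<open>Differentiability classes\<close>

definition C1_on :: "('a::real_normed_vector \<Rightarrow> 'b::real_normed_vector) \<Rightarrow> 'a set \<Rightarrow> bool" where
  "C1_on f S \<longleftrightarrow> (\<exists>f' :: 'a \<Rightarrow> 'a \<Rightarrow>\<^sub>L 'b.
     (\<forall>x\<in>S. (f has_derivative blinfun_apply (f' x)) (at x)) \<and> continuous_on S f')"

definition C2_on :: "('a::real_normed_vector \<Rightarrow> 'b::real_normed_vector) \<Rightarrow> 'a set \<Rightarrow> bool" where
  "C2_on f S \<longleftrightarrow> (\<exists>f' :: 'a \<Rightarrow> 'a \<Rightarrow>\<^sub>L 'b.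
     (\<forall>x\<in>S. (f has_derivative blinfun_apply (f' x)) (at x)) \<and> C1_on f' S)"

definition diffeo_on ::
    "('a::real_normed_vector \<Rightarrow> 'b::real_normed_vector) \<Rightarrow> 'a set \<Rightarrow> 'b set \<Rightarrow> bool" where
  "diffeo_on f A B \<longleftrightarrow> open A \<and> open B \<and> bij_betw f A B \<and> C1_on f A \<and> C1_on (inv_into A f) B"


subsection \<open>Contact transformations and their distortion\<close>

definition contact_form :: "heis \<Rightarrow> heis \<Rightarrow> real" where
  "contact_form p v = v $ 3 + 2 * p $ 1 * v $ 2 - 2 * p $ 2 * v $ 1"

definition X_field :: "heis \<Rightarrow> heis" where
  "X_field p = vector [1, 0, 2 * p $ 2]"

definition Y_field :: "heis \<Rightarrow> heis" where
  "Y_field p = vector [0, 1, - 2 * p $ 1]"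

definition Z_op :: "(heis \<Rightarrow> complex) \<Rightarrow> heis \<Rightarrow> complex" where
  "Z_op g p = (frechet_derivative g (at p) (X_field p)
               - \<i> * frechet_derivative g (at p) (Y_field p)) / 2"

definition Zbar_op :: "(heis \<Rightarrow> complex) \<Rightarrow> heis \<Rightarrow> complex" where
  "Zbar_op g p = (frechet_derivative g (at p) (X_field p)
                  + \<i> * frechet_derivative g (at p) (Y_field p)) / 2"

definition horizontal_part :: "(heis \<Rightarrow> heis) \<Rightarrow> heis \<Rightarrow> complex" where
  "horizontal_part f p = Complex (f p $ 1) (f p $ 2)"

definition pullback_factor :: "(heis \<Rightarrow> heis) \<Rightarrow> heis \<Rightarrow> real \<Rightarrow> bool" where
  "pullback_factor f p l \<longleftrightarrow>
     (\<forall>v. contact_form (f p) (frechet_derivative f (at p) v) = l * contact_form p v)"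

definition contact_transformation :: "(heis \<Rightarrow> heis) \<Rightarrow> heis set \<Rightarrow> heis set \<Rightarrow> bool" where
  "contact_transformation f \<Omega> \<Omega>' \<longleftrightarrow>
     diffeo_on f \<Omega> \<Omega>' \<and> (\<forall>p\<in>\<Omega>. \<exists>l. l \<noteq> 0 \<and> pullback_factor f p l)"

text \<open>The function \<open>\<lambda>\<close>; it is unique because \<open>contact_form p\<close> takes the value 1 on \<open>\<partial>\<^sub>t\<close>.\<close>

definition contact_factor :: "(heis \<Rightarrow> heis) \<Rightarrow> heis \<Rightarrow> real" where
  "contact_factor f p = (THE l. pullback_factor f p l)"

definition orientation_preserving :: "(heis \<Rightarrow> heis) \<Rightarrow> heis set \<Rightarrow> bool" where
  "orientation_preserving f \<Omega> \<longleftrightarrow> (\<forall>p\<in>\<Omega>. 0 < contact_factor f p)"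

definition distortion :: "(heis \<Rightarrow> heis) \<Rightarrow> heis \<Rightarrow> real" where
  "distortion f p =
     (cmod (Z_op (horizontal_part f) p) + cmod (Zbar_op (horizontal_part f) p)) /
     (cmod (Z_op (horizontal_part f) p) - cmod (Zbar_op (horizontal_part f) p))"

definition quasiconformal :: "(heis \<Rightarrow> heis) \<Rightarrow> heis set \<Rightarrow> bool" where
  "quasiconformal f \<Omega> \<longleftrightarrow> esssup (restrict_space lborel \<Omega>) (\<lambda>p. ereal (distortion f p)) < \<infinity>"

definition C2_contact_qc :: "(heis \<Rightarrow> heis) \<Rightarrow> heis set \<Rightarrow> heis set \<Rightarrow> bool" where
  "C2_contact_qc f \<Omega> \<Omega>' \<longleftrightarrow> contact_transformation f \<Omega> \<Omega>' \<and> C2_on f \<Omega> \<and>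
     orientation_preserving f \<Omega> \<and> quasiconformal f \<Omega>"


subsection \<open>Regular surfaces\<close>

definition regular_patch :: "(real^2 \<Rightarrow> heis) \<Rightarrow> (real^2) set \<Rightarrow> bool" where
  "regular_patch \<sigma> U \<longleftrightarrow> open U \<and> C2_on \<sigma> U \<and>
     (\<forall>w\<in>U. inj (frechet_derivative \<sigma> (at w))) \<and> (\<exists>g. homeomorphism U (\<sigma> ` U) \<sigma> g)"

definition patch_of :: "heis set \<Rightarrow> (real^2 \<Rightarrow> heis) \<Rightarrow> (real^2) set \<Rightarrow> bool" where
  "patch_of S \<sigma> U \<longleftrightarrow> regular_patch \<sigma> U \<and> openin (top_of_set S) (\<sigma> ` U)"

text \<open>
  A surface is represented by its set of points. Everything below depends on an orientation only
  through its existence, which is expressed by a continuous unit normal field \<open>\<nu>\<close>.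
\<close>

definition regular_surface :: "heis set \<Rightarrow> bool" where
  "regular_surface S \<longleftrightarrow> (\<forall>p\<in>S. \<exists>\<sigma> U. patch_of S \<sigma> U \<and> p \<in> \<sigma> ` U) \<and>
     (\<exists>\<nu> :: heis \<Rightarrow> heis. continuous_on S \<nu> \<and> (\<forall>p\<in>S. norm (\<nu> p) = 1) \<and>
        (\<forall>\<sigma> U w v. patch_of S \<sigma> U \<longrightarrow> w \<in> U \<longrightarrow>
           \<nu> (\<sigma> w) \<bullet> frechet_derivative \<sigma> (at w) v = 0))"

text \<open>\<open>jac \<sigma> i j\<close> is the minor \<open>\<partial>(\<sigma>\<^sub>i, \<sigma>\<^sub>j) / \<partial>(u, v)\<close>.\<close>

definition jac :: "(real^2 \<Rightarrow> heis) \<Rightarrow> 3 \<Rightarrow> 3 \<Rightarrow> real^2 \<Rightarrow> real" where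
  "jac \<sigma> i j w =
     (let \<sigma>u = frechet_derivative \<sigma> (at w) (axis 1 1);
          \<sigma>v = frechet_derivative \<sigma> (at w) (axis 2 1)
      in \<sigma>u $ i * \<sigma>v $ j - \<sigma>v $ i * \<sigma>u $ j)"

definition horizontal_normal :: "(real^2 \<Rightarrow> heis) \<Rightarrow> real^2 \<Rightarrow> heis" where
  "horizontal_normal \<sigma> w =
     (jac \<sigma> 2 3 w + 2 * \<sigma> w $ 2 * jac \<sigma> 1 2 w) *\<^sub>R X_field (\<sigma> w) +
     (jac \<sigma> 3 1 w - 2 * \<sigma> w $ 1 * jac \<sigma> 1 2 w) *\<^sub>R Y_field (\<sigma> w)"

text \<open>
  On the horizontal plane at any point this is the norm making \<open>X, Y\<close> orthonormal: the first two
  coordinates of \<open>a X + b Y\<close> are \<open>a\<close> and \<open>b\<close>.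
\<close>

definition hnorm :: "heis \<Rightarrow> real" where
  "hnorm v = sqrt ((v $ 1)\<^sup>2 + (v $ 2)\<^sup>2)"

text \<open>
  The measure \<open>d\<S>\<^sup>h\<close> on \<open>S\<close>, extended by zero to the whole space: it is the unique measure that
  is \<open>\<parallel>N\<^sup>h\<parallel> du dv\<close> in every patch.
\<close>

definition horizontal_area :: "heis set \<Rightarrow> heis measure" where
  "horizontal_area S = (THE M. sets M = sets borel \<and> emeasure M (- S) = 0 \<and>
     (\<forall>\<sigma> U A. patch_of S \<sigma> U \<longrightarrow> A \<in> sets borel \<longrightarrow>
        emeasure M (A \<inter> \<sigma> ` U) =
          (\<integral>\<^sup>+w\<in>U. indicator A (\<sigma> w) * ennreal (hnorm (horizontal_normal \<sigma> w)) \<partial>lborel)))"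

definition minimal_stretching :: "(heis \<Rightarrow> heis) \<Rightarrow> heis set \<Rightarrow> bool" where
  "minimal_stretching f S \<longleftrightarrow> (\<forall>\<sigma> U. patch_of S \<sigma> U \<longrightarrow>
     (\<forall>w\<in>U. horizontal_normal \<sigma> w \<noteq> 0 \<longrightarrow>
        hnorm (horizontal_normal (f \<circ> \<sigma>) w) =
          contact_factor f (\<sigma> w) *
          (cmod (Z_op (horizontal_part f) (\<sigma> w)) - cmod (Zbar_op (horizontal_part f) (\<sigma> w))) *
          hnorm (horizontal_normal \<sigma> w)))"


subsection \<open>Modulus of a family of surfaces and mean distortion\<close>

definition Adm :: "heis set set \<Rightarrow> (heis \<Rightarrow> real) set" where
  "Adm \<Sigma> = {\<rho>. \<rho> \<in> borel_measurable borel \<and> (\<forall>p. 0 \<le> \<rho> p) \<and>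
     (\<forall>S\<in>\<Sigma>. 1 \<le> (\<integral>\<^sup>+p. ennreal (\<rho> p) \<partial>horizontal_area S))}"

definition Modulus :: "heis set set \<Rightarrow> ennreal" where
  "Modulus \<Sigma> = (INF \<rho>\<in>Adm \<Sigma>. \<integral>\<^sup>+p. ennreal (\<rho> p powr (4/3)) \<partial>lborel)"

definition image_family :: "(heis \<Rightarrow> heis) \<Rightarrow> heis set set \<Rightarrow> heis set set" where
  "image_family f \<Sigma> = {f ` S | S. S \<in> \<Sigma>}"

definition mean_distortion :: "heis set \<Rightarrow> (heis \<Rightarrow> heis) \<Rightarrow> (heis \<Rightarrow> real) \<Rightarrow> ennreal" where
  "mean_distortion \<Omega> f \<rho> =
     (\<integral>\<^sup>+p\<in>\<Omega>. ennreal (distortion f p powr (2/3) * \<rho> p powr (4/3)) \<partial>lborel) /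
     (\<integral>\<^sup>+p\<in>\<Omega>. ennreal (\<rho> p powr (4/3)) \<partial>lborel)"


subsection \<open>Foliations by surface patches\<close>

definition leaf :: "((real^2) \<times> real \<Rightarrow> heis) \<Rightarrow> real \<Rightarrow> real^2 \<Rightarrow> heis" where
  "leaf \<Phi> \<tau> w = \<Phi> (w, \<tau>)"

definition leaves :: "((real^2) \<times> real \<Rightarrow> heis) \<Rightarrow> (real^2) set \<Rightarrow> real set \<Rightarrow> heis set set" where
  "leaves \<Phi> U J = {leaf \<Phi> \<tau> ` U | \<tau>. \<tau> \<in> J}"

definition volume_disintegration ::
    "((real^2) \<times> real \<Rightarrow> heis) \<Rightarrow> (real^2) set \<Rightarrow> real set \<Rightarrow> heis set \<Rightarrow> real measure \<Rightarrow> bool" where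
  "volume_disintegration \<Phi> U J \<Omega> \<mu> \<longleftrightarrow>
     sets \<mu> = sets (restrict_space borel J) \<and>
     (\<forall>g :: heis \<Rightarrow> real. g \<in> borel_measurable (restrict_space borel \<Omega>) \<longrightarrow> (\<forall>p\<in>\<Omega>. 0 \<le> g p) \<longrightarrow>
        (\<integral>\<^sup>+p\<in>\<Omega>. ennreal (g p) \<partial>lborel) =
        (\<integral>\<^sup>+\<tau>. (\<integral>\<^sup>+w\<in>U. ennreal (g (\<Phi> (w, \<tau>)) *
             hnorm (horizontal_normal (leaf \<Phi> \<tau>) w) powr (4/3)) \<partial>lborel) \<partial>\<mu>))"

definition rho0 :: "((real^2) \<times> real \<Rightarrow> heis) \<Rightarrow> (real^2) set \<Rightarrow> real set \<Rightarrow> heis \<Rightarrow> real" where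
  "rho0 \<Phi> U J p =
     (let (w, \<tau>) = inv_into (U \<times> J) \<Phi> p
      in if p \<in> \<Phi> ` (U \<times> J) \<and> horizontal_normal (leaf \<Phi> \<tau>) w \<noteq> 0
         then 1 / (measure lborel U * hnorm (horizontal_normal (leaf \<Phi> \<tau>) w)) else 0)"

end

theory Submission
  imports Defs
begin

text \<open>
  Write \<open>\<lambda>\<close> for the contact factor of \<open>f\<close>, \<open>K\<close> for its distortion and
  \<open>s = \<lambda> (\<bar>Z f\<^sub>I\<bar> - \<bar>W f\<^sub>I\<bar>)\<close> for the factor in the minimal stretching property
  (\<open>area_stretch\<close>), where \<open>W\<close> is the conjugate \<open>(X + \<i> Y)/2\<close> of \<open>Z\<close>. The theorem compares the integrals
  of \<open>K\<^bsup>2/3\<^esup> \<rho>\<^sub>0\<^bsup>4/3\<^esup>\<close> for \<open>f\<^sub>0\<close> and \<open>f\<close>; each of them is tied to a modulus, by two facts about contact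
  transformations.

  \<^item> The Jacobian of \<open>f\<close> is \<open>\<lambda>\<^sup>2\<close>, and \<open>\<lambda> = \<bar>Z f\<^sub>I\<bar>\<^sup>2 - \<bar>W f\<^sub>I\<bar>\<^sup>2\<close>; hence \<open>K\<^bsup>2/3\<^esup> s\<^bsup>4/3\<^esup>\<close> is the Jacobian
    (\<open>distortion_powr_area_stretch\<close>). This is where the exponents \<open>2/3\<close> and \<open>4/3\<close> fit together.
  \<^item> \<open>f\<close> stretches horizontal area by a factor of at least \<open>s\<close>. Up to a right-angle rotation, the
    horizontal normal of a patch is \<open>\<omega>(\<sigma>\<^sub>v) \<sigma>\<^sub>u - \<omega>(\<sigma>\<^sub>u) \<sigma>\<^sub>v\<close>, a horizontal tangent vector; since \<open>f\<close> pulls \<open>\<omega>\<close>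
    back to \<open>\<lambda> \<omega>\<close>, it is mapped to \<open>\<lambda>\<close> times its image under the differential, and the differential
    shrinks no horizontal vector by more than \<open>\<bar>Z f\<^sub>I\<bar> - \<bar>W f\<^sub>I\<bar>\<close>.

  By these facts, pushing \<open>\<rho>\<^sub>0 / s\<close> forward along \<open>f\<close> produces a density that is admissible for \<open>f(\<Sigma>)\<close> and
  whose energy is the integral of \<open>K\<^bsup>2/3\<^esup> \<rho>\<^sub>0\<^bsup>4/3\<^esup>\<close>, which therefore bounds \<open>Mod(f(\<Sigma>))\<close> from above
  (\<open>Modulus_image_le\<close>). For \<open>f\<^sub>0\<close> and a leaf the stretching factor is exactly \<open>s\<close>. If \<open>\<rho>\<close> is admissible
  for the images of the leaves, Jensen's inequality on the leaf bounds the integral of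
  \<open>(\<rho> \<circ> f\<^sub>0)\<^bsup>4/3\<^esup> s\<^bsup>4/3\<^esup> \<parallel>N\<^sup>h\<parallel>\<^bsup>4/3\<^esup>\<close> over \<open>U\<close> from below by \<open>\<bar>U\<bar>\<^bsup>-1/3\<^esup>\<close>; as \<open>K\<close> is constant on the leaf, one may
  multiply by \<open>K\<^bsup>2/3\<^esup>\<close> and integrate over the leaves, and \<open>\<rho>\<^sub>0\<close> is chosen so that the lower bound
  becomes the integral of \<open>K\<^bsup>2/3\<^esup> \<rho>\<^sub>0\<^bsup>4/3\<^esup>\<close> (\<open>Modulus_image_leaves_ge\<close>). The inequality
  between the two moduli links the two estimates.

  Two pieces of groundwork are needed. The formula for \<open>\<lambda>\<close> is the identity \<open>d(f\<^sup>*\<omega>) = f\<^sup>*d\<omega>\<close> evaluated on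
  \<open>X\<close> and \<open>Y\<close>; it rests on the symmetry of second derivatives. The horizontal area of a surface is
  defined as the unique measure with prescribed values in all patches, so its existence has
  to be shown: patches agree on overlaps by the change of variables formula, and countably many of them
  cover the surface.
\<close>

section \<open>Calculus of twice differentiable maps\<close>

lemma C1_onI:
  assumes "\<And>x. x \<in> S \<Longrightarrow> (f has_derivative blinfun_apply (f' x)) (at x)" "continuous_on S f'"
  shows "C1_on f S"
  using assms unfolding C1_on_def by blast

lemma C2_onI:
  assumes "\<And>x. x \<in> S \<Longrightarrow> (f has_derivative blinfun_apply (f' x)) (at x)" "C1_on f' S"
  shows "C2_on f S"
  using assms unfolding C2_on_def by blast

lemma C1_onE:
  assumes "C1_on f S"
  obtains f' where "\<And>x. x \<in> S \<Longrightarrow> (f has_derivative blinfun_apply (f' x)) (at x)" "continuous_on S f'"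
  using assms unfolding C1_on_def by blast

lemma C2_onE:
  assumes "C2_on f S"
  obtains f' where "\<And>x. x \<in> S \<Longrightarrow> (f has_derivative blinfun_apply (f' x)) (at x)" "C1_on f' S"
  using assms unfolding C2_on_def by blast

lemma C1_on_imp_continuous_on: "C1_on f S \<Longrightarrow> continuous_on S f"
  unfolding C1_on_def by (meson continuous_at_imp_continuous_on has_derivative_continuous)

lemma C2_on_imp_C1_on: "C2_on f S \<Longrightarrow> C1_on f S"
  unfolding C2_on_def using C1_on_imp_continuous_on by (auto simp: C1_on_def)

lemma C1_on_imp_has_derivative:
  "C1_on f S \<Longrightarrow> x \<in> S \<Longrightarrow> (f has_derivative frechet_derivative f (at x)) (at x)"
  unfolding C1_on_def by (metis differentiableI frechet_derivative_works)

lemma C1_on_imp_continuous_frechet: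
  fixes f :: "'a::real_normed_vector \<Rightarrow> 'b::real_normed_vector"
  assumes "C1_on f S" "continuous_on S v"
  shows "continuous_on S (\<lambda>x. frechet_derivative f (at x) (v x))"
proof -
  obtain f' :: "'a \<Rightarrow> 'a \<Rightarrow>\<^sub>L 'b" where f': "\<And>x. x \<in> S \<Longrightarrow> (f has_derivative blinfun_apply (f' x)) (at x)"
    and c: "continuous_on S f'" using assms unfolding C1_on_def by blast
  have "continuous_on S (\<lambda>x. blinfun_apply (f' x) (v x))"
    by (intro continuous_intros c assms)
  then show ?thesis
    by (rule continuous_on_eq) (metis f' frechet_derivative_at)
qed

lemma C1_on_compose:
  fixes g :: "'a::real_normed_vector \<Rightarrow> 'b::real_normed_vector" and f :: "'b \<Rightarrow> 'c::real_normed_vector"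
  assumes "C1_on g S" "C1_on f T" "g ` S \<subseteq> T"
  shows "C1_on (\<lambda>x. f (g x)) S"
proof -
  obtain g' :: "'a \<Rightarrow> 'a \<Rightarrow>\<^sub>L 'b" where g': "\<And>x. x \<in> S \<Longrightarrow> (g has_derivative blinfun_apply (g' x)) (at x)"
    "continuous_on S g'" using assms unfolding C1_on_def by blast
  obtain f' :: "'b \<Rightarrow> 'b \<Rightarrow>\<^sub>L 'c" where f': "\<And>x. x \<in> T \<Longrightarrow> (f has_derivative blinfun_apply (f' x)) (at x)"
    "continuous_on T f'" using assms unfolding C1_on_def by blast
  have "((\<lambda>x. f (g x)) has_derivative blinfun_apply (f' (g x) o\<^sub>L g' x)) (at x)" if "x \<in> S" for x
    using diff_chain_at[OF g'(1)[OF that] f'(1)] assms(3) that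
    by (auto simp: o_def blinfun_compose.rep_eq image_subset_iff)
  moreover have "continuous_on S (\<lambda>x. f' (g x) o\<^sub>L g' x)"
    using continuous_on_compose2[OF f'(2) C1_on_imp_continuous_on[OF assms(1)] assms(3)] g'(2)
    by (intro continuous_intros)
  ultimately show ?thesis by (rule C1_onI)
qed

text \<open>
  Composition of bounded operators is a bounded bilinear map, so the product rule applies. With the
  chain rule this makes compositions of \<open>C\<^sup>2\<close> maps \<open>C\<^sup>2\<close>.
\<close>

lemma C1_on_blinfun_compose:
  fixes A :: "'a::real_normed_vector \<Rightarrow> 'c::real_normed_vector \<Rightarrow>\<^sub>L 'd::real_normed_vector"
    and B :: "'a \<Rightarrow> 'b::real_normed_vector \<Rightarrow>\<^sub>L 'c"
  assumes "C1_on A S" "C1_on B S"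
  shows "C1_on (\<lambda>x. A x o\<^sub>L B x) S"
proof -
  interpret bc: bounded_bilinear "(o\<^sub>L) :: ('c \<Rightarrow>\<^sub>L 'd) \<Rightarrow> ('b \<Rightarrow>\<^sub>L 'c) \<Rightarrow> ('b \<Rightarrow>\<^sub>L 'd)"
    by (rule bounded_bilinear_blinfun_compose)
  obtain A' :: "'a \<Rightarrow> 'a \<Rightarrow>\<^sub>L ('c \<Rightarrow>\<^sub>L 'd)" where A': "\<And>x. x \<in> S \<Longrightarrow> (A has_derivative blinfun_apply (A' x)) (at x)"
    "continuous_on S A'" using assms unfolding C1_on_def by blast
  obtain B' :: "'a \<Rightarrow> 'a \<Rightarrow>\<^sub>L ('b \<Rightarrow>\<^sub>L 'c)" where B': "\<And>x. x \<in> S \<Longrightarrow> (B has_derivative blinfun_apply (B' x)) (at x)"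
    "continuous_on S B'" using assms unfolding C1_on_def by blast
  let ?D = "\<lambda>x. (bc.prod_right (A x) o\<^sub>L B' x) + (bc.prod_left (B x) o\<^sub>L A' x)"
  have "((\<lambda>x. A x o\<^sub>L B x) has_derivative blinfun_apply (?D x)) (at x)" if "x \<in> S" for x
  proof (rule has_derivative_eq_rhs[OF bc.FDERIV[OF A'(1)[OF that] B'(1)[OF that]]])
    show "(\<lambda>h. (A x o\<^sub>L blinfun_apply (B' x) h) + (blinfun_apply (A' x) h o\<^sub>L B x)) = blinfun_apply (?D x)"
      by (auto simp: blinfun.bilinear_simps bc.prod_right.rep_eq bc.prod_left.rep_eq)
  qed
  moreover have "continuous_on S ?D"
  proof (rule continuous_on_add)
    have "continuous_on S (\<lambda>x. bc.prod_right (A x))"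
      by (rule bounded_linear.continuous_on[OF bc.bounded_linear_prod_right C1_on_imp_continuous_on[OF assms(1)]])
    then show "continuous_on S (\<lambda>x. bc.prod_right (A x) o\<^sub>L B' x)"
      using B'(2) by (rule bounded_bilinear.continuous_on[OF bounded_bilinear_blinfun_compose])
    have "continuous_on S (\<lambda>x. bc.prod_left (B x))"
      by (rule bounded_linear.continuous_on[OF bc.bounded_linear_prod_left C1_on_imp_continuous_on[OF assms(2)]])
    then show "continuous_on S (\<lambda>x. bc.prod_left (B x) o\<^sub>L A' x)"
      using A'(2) by (rule bounded_bilinear.continuous_on[OF bounded_bilinear_blinfun_compose])
  qed
  ultimately show ?thesis by (rule C1_onI)
qed

lemma C2_on_compose:
  fixes g :: "'a::real_normed_vector \<Rightarrow> 'b::real_normed_vector" and f :: "'b \<Rightarrow> 'c::real_normed_vector"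
  assumes "C2_on g S" "C2_on f T" "g ` S \<subseteq> T"
  shows "C2_on (\<lambda>x. f (g x)) S"
proof -
  obtain g' :: "'a \<Rightarrow> 'a \<Rightarrow>\<^sub>L 'b" where g': "\<And>x. x \<in> S \<Longrightarrow> (g has_derivative blinfun_apply (g' x)) (at x)"
    "C1_on g' S" using assms unfolding C2_on_def by blast
  obtain f' :: "'b \<Rightarrow> 'b \<Rightarrow>\<^sub>L 'c" where f': "\<And>x. x \<in> T \<Longrightarrow> (f has_derivative blinfun_apply (f' x)) (at x)"
    "C1_on f' T" using assms unfolding C2_on_def by blast
  have "((\<lambda>x. f (g x)) has_derivative blinfun_apply (f' (g x) o\<^sub>L g' x)) (at x)" if "x \<in> S" for x
    using diff_chain_at[OF g'(1)[OF that] f'(1)] assms(3) that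
    by (auto simp: o_def blinfun_compose.rep_eq image_subset_iff)
  moreover have "C1_on (\<lambda>x. f' (g x) o\<^sub>L g' x) S"
    using C1_on_blinfun_compose[OF C1_on_compose[OF C2_on_imp_C1_on[OF assms(1)] f'(2) assms(3)] g'(2)] .
  ultimately show ?thesis by (rule C2_onI)
qed

text \<open>
  The second difference of \<open>f\<close> along \<open>v\<close> and \<open>w\<close> is the increment over \<open>[0, 1]\<close> of
  \<open>t \<mapsto> f (p + t s v + s w) - f (p + t s v)\<close>. The derivative of this function is \<open>s\<^sup>2 f'' w v\<close> up to an error
  controlled by the linear approximation of \<open>f'\<close> at \<open>p\<close>, and the mean value inequality transfers the
  error to the increment.
\<close>

lemma second_difference_bound:
  fixes f :: "'a::real_normed_vector \<Rightarrow> 'b::real_normed_vector" and f' :: "'a \<Rightarrow> 'a \<Rightarrow>\<^sub>L 'b"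
  assumes S: "ball p r \<subseteq> S"
    and f: "\<And>x. x \<in> S \<Longrightarrow> (f has_derivative blinfun_apply (f' x)) (at x)"
    and lin: "linear f''"
    and f'': "\<And>h. norm h < r \<Longrightarrow> norm (f' (p + h) - f' p - f'' h) \<le> e * norm h"
    and s: "0 < s" "s * (norm v + norm w) < r" and e: "0 \<le> e"
  shows "norm (f (p + s *\<^sub>R v + s *\<^sub>R w) - f (p + s *\<^sub>R v) - f (p + s *\<^sub>R w) + f p
           - s\<^sup>2 *\<^sub>R blinfun_apply (f'' w) v) \<le> 2 * e * s\<^sup>2 * (norm v + norm w) * norm v"
proof -
  interpret f'': linear f'' by (rule lin)
  define x1 where "x1 t = p + t *\<^sub>R s *\<^sub>R v + s *\<^sub>R w" for t :: real
  define x0 where "x0 t = p + t *\<^sub>R s *\<^sub>R v" for t :: real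
  define g where "g t = f (x1 t) - f (x0 t) - t *\<^sub>R (s\<^sup>2 *\<^sub>R blinfun_apply (f'' w) v)" for t
  define D where "D t = s *\<^sub>R (blinfun_apply (f' (x1 t)) v - blinfun_apply (f' (x0 t)) v) - s\<^sup>2 *\<^sub>R blinfun_apply (f'' w) v" for t
  have n1: "norm (t *\<^sub>R s *\<^sub>R v + s *\<^sub>R w) \<le> s * (norm v + norm w)"
    and n0: "norm (t *\<^sub>R s *\<^sub>R v) \<le> s * (norm v + norm w)" if "t \<in> {0..1}" for t
  proof -
    have "norm (t *\<^sub>R s *\<^sub>R v) \<le> s * norm v" using that s(1) by (auto intro!: mult_right_mono simp: mult_le_cancel_right1 mult_left_le_one_le)
    moreover have "norm (s *\<^sub>R w) = s * norm w" using s(1) by simp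
    moreover have "0 \<le> s * norm w" using s by simp
    ultimately show "norm (t *\<^sub>R s *\<^sub>R v + s *\<^sub>R w) \<le> s * (norm v + norm w)"
      "norm (t *\<^sub>R s *\<^sub>R v) \<le> s * (norm v + norm w)"
      using norm_triangle_ineq[of "t *\<^sub>R s *\<^sub>R v" "s *\<^sub>R w"] by (auto simp: distrib_left)
  qed
  have in1: "x1 t \<in> S" and in0: "x0 t \<in> S" if "t \<in> {0..1}" for t
    using n1[OF that] n0[OF that] s(2) S unfolding x1_def x0_def
    by (auto simp: subset_iff dist_norm add.assoc norm_minus_commute)
  have der: "(g has_derivative (\<lambda>h. h *\<^sub>R D t)) (at t within {0..1})" if t: "t \<in> {0..1}" for t
  proof -
    have d1: "(x1 has_derivative (\<lambda>h. h *\<^sub>R s *\<^sub>R v)) (at t within {0..1})"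
      unfolding x1_def by (auto intro!: derivative_eq_intros)
    have d0: "(x0 has_derivative (\<lambda>h. h *\<^sub>R s *\<^sub>R v)) (at t within {0..1})"
      unfolding x0_def by (auto intro!: derivative_eq_intros)
    show ?thesis unfolding g_def
      by (rule derivative_eq_intros has_derivative_compose[OF d1 f[OF in1[OF t]]]
          has_derivative_compose[OF d0 f[OF in0[OF t]]] refl)+
         (auto simp: D_def fun_eq_iff blinfun.bilinear_simps scaleR_diff_right)
  qed
  have bound: "norm (D t) \<le> 2 * e * s\<^sup>2 * (norm v + norm w) * norm v" if t: "t \<in> {0..1}" for t
  proof -
    define h1 where "h1 = t *\<^sub>R s *\<^sub>R v + s *\<^sub>R w"
    define h0 where "h0 = t *\<^sub>R s *\<^sub>R v"
    have "D t = s *\<^sub>R blinfun_apply ((f' (p + h1) - f' p - f'' h1) - (f' (p + h0) - f' p - f'' h0)) v"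
      unfolding D_def h1_def h0_def x1_def x0_def
      by (simp add: blinfun.bilinear_simps f''.add f''.scale power2_eq_square algebra_simps)
    also have "norm \<dots> \<le> s * (norm ((f' (p + h1) - f' p - f'' h1) - (f' (p + h0) - f' p - f'' h0)) * norm v)"
      using s(1) norm_blinfun by (simp add: mult_left_mono)
    also have "\<dots> \<le> s * ((e * (s * (norm v + norm w)) + e * (s * (norm v + norm w))) * norm v)"
    proof -
      have "norm (f' (p + h1) - f' p - f'' h1) \<le> e * (s * (norm v + norm w))"
        using f''[of h1] n1[OF t] s(2) e mult_left_mono[OF n1[OF t] e] unfolding h1_def by linarith
      moreover have "norm (f' (p + h0) - f' p - f'' h0) \<le> e * (s * (norm v + norm w))"
        using f''[of h0] n0[OF t] s(2) e mult_left_mono[OF n0[OF t] e] unfolding h0_def by linarith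
      ultimately have "norm ((f' (p + h1) - f' p - f'' h1) - (f' (p + h0) - f' p - f'' h0))
          \<le> e * (s * (norm v + norm w)) + e * (s * (norm v + norm w))"
        by (meson add_mono norm_triangle_ineq4 order_trans)
      then show ?thesis using s(1) by (intro mult_left_mono mult_right_mono) auto
    qed
    finally show ?thesis by (simp add: power2_eq_square algebra_simps)
  qed
  have "norm (g 1 - g 0) \<le> (2 * e * s\<^sup>2 * (norm v + norm w) * norm v) * norm (1 - 0 :: real)"
  proof (rule differentiable_bound[of "{0..1::real}" g "\<lambda>t h. h *\<^sub>R D t"])
    show "onorm (\<lambda>h. h *\<^sub>R D t) \<le> 2 * e * s\<^sup>2 * (norm v + norm w) * norm v" if "t \<in> {0..1}" for t
    proof (rule onorm_le)
      show "norm (x *\<^sub>R D t) \<le> 2 * e * s\<^sup>2 * (norm v + norm w) * norm v * norm x" for x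
        using mult_right_mono[OF bound[OF that], of "norm x"] by (simp only: norm_scaleR real_norm_def mult.commute[of "\<bar>x\<bar>"])
    qed
  qed (auto intro: der)
  then show ?thesis by (simp add: g_def x1_def x0_def algebra_simps)
qed

text \<open>
  The second difference is symmetric in \<open>v\<close> and \<open>w\<close>, while up to \<open>o(s\<^sup>2)\<close> it equals \<open>s\<^sup>2 f'' w v\<close>; so the two
  orders of differentiation give the same limit.
\<close>

lemma symmetric_second_derivative:
  fixes f :: "'a::real_normed_vector \<Rightarrow> 'b::real_normed_vector" and f' :: "'a \<Rightarrow> 'a \<Rightarrow>\<^sub>L 'b"
  assumes "open S" "p \<in> S"
    and f: "\<And>x. x \<in> S \<Longrightarrow> (f has_derivative blinfun_apply (f' x)) (at x)"
    and f'': "(f' has_derivative f'') (at p)"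
  shows "blinfun_apply (f'' v) w = blinfun_apply (f'' w) v"
proof -
  define C where "C = 2 * (norm v + norm w) * (norm v + norm w)"
  have C: "0 \<le> C" unfolding C_def by simp
  have "norm (blinfun_apply (f'' v) w - blinfun_apply (f'' w) v) \<le> e * C" if e: "0 < e" for e
  proof -
    obtain r1 where r1: "0 < r1" "ball p r1 \<subseteq> S" using assms(1,2) open_contains_ball by blast
    obtain r2 where r2: "0 < r2" "\<And>y. norm (y - p) < r2 \<Longrightarrow> norm (f' y - f' p - f'' (y - p)) \<le> e * norm (y - p)"
      using f'' e unfolding has_derivative_at_alt by blast
    define r where "r = min r1 r2"
    have r: "0 < r" using r1 r2 by (simp add: r_def)
    have bl: "linear f''" using f'' has_derivative_linear by blast
    \<comment> \<open>A step so short that the four corners of the parallelogram stay in the ball of radius \<open>r\<close>.\<close>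
    obtain s where s: "0 < s" "s * (norm v + norm w) < r"
    proof
      show "0 < r / (norm v + norm w + 1)" using r by (simp add: add_nonneg_pos)
      show "r / (norm v + norm w + 1) * (norm v + norm w) < r"
        using r by (simp add: divide_simps add_nonneg_pos)
    qed
    have S: "ball p r \<subseteq> S" using r1(2) by (auto simp: r_def)
    have b: "norm (f' (p + h) - f' p - f'' h) \<le> e * norm h" if "norm h < r" for h
      using r2(2)[of "p + h"] that by (simp add: r_def)
    let ?d = "f (p + s *\<^sub>R v + s *\<^sub>R w) - f (p + s *\<^sub>R v) - f (p + s *\<^sub>R w) + f p"
    have s': "s * (norm w + norm v) < r" using s by (simp add: add.commute)
    have 1: "norm (?d - s\<^sup>2 *\<^sub>R blinfun_apply (f'' w) v) \<le> 2 * e * s\<^sup>2 * (norm v + norm w) * norm v"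
      using second_difference_bound[OF S f bl b s] e by simp
    have 2: "norm (?d - s\<^sup>2 *\<^sub>R blinfun_apply (f'' v) w) \<le> 2 * e * s\<^sup>2 * (norm w + norm v) * norm w"
      using second_difference_bound[OF S f bl b s(1) s'] e by (simp add: algebra_simps)
    have "s\<^sup>2 * norm (blinfun_apply (f'' v) w - blinfun_apply (f'' w) v)
        = norm ((?d - s\<^sup>2 *\<^sub>R blinfun_apply (f'' w) v) - (?d - s\<^sup>2 *\<^sub>R blinfun_apply (f'' v) w))"
      by (simp flip: scaleR_diff_right)
    also have "\<dots> \<le> s\<^sup>2 * (e * C)"
      using norm_triangle_ineq4[of "?d - s\<^sup>2 *\<^sub>R blinfun_apply (f'' w) v" "?d - s\<^sup>2 *\<^sub>R blinfun_apply (f'' v) w"] 1 2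
      unfolding C_def by (simp add: algebra_simps)
    finally show ?thesis using s(1) by simp
  qed
  then have "norm (blinfun_apply (f'' v) w - blinfun_apply (f'' w) v) \<le> e" if "0 < e" for e
  proof -
    have "norm (blinfun_apply (f'' v) w - blinfun_apply (f'' w) v) \<le> e / (C + 1) * C"
      using \<open>\<And>e. 0 < e \<Longrightarrow> _ \<le> e * C\<close>[of "e / (C + 1)"] that C by simp
    also have "\<dots> \<le> e" using C that by (simp add: divide_simps mult_left_mono)
    finally show ?thesis .
  qed
  then have "norm (blinfun_apply (f'' v) w - blinfun_apply (f'' w) v) \<le> 0"
    by (rule field_le_epsilon) simp
  then show ?thesis by simp
qed

section \<open>Distortion of contact transformations\<close>

lemma X_field_axis: "X_field p = axis 1 1 + (2 * p $ 2) *\<^sub>R axis 3 1"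
  and Y_field_axis: "Y_field p = axis 2 1 + (- 2 * p $ 1) *\<^sub>R axis 3 1"
  by (simp_all add: X_field_def Y_field_def vec_eq_iff forall_3 axis_def)

lemma C2_contact_qcD:
  assumes "C2_contact_qc f \<Omega> \<Omega>'"
  shows "open \<Omega>" "open \<Omega>'" "bij_betw f \<Omega> \<Omega>'" "C2_on f \<Omega>" "C1_on f \<Omega>" "C1_on (inv_into \<Omega> f) \<Omega>'"
    "p \<in> \<Omega> \<Longrightarrow> f differentiable at p"
    "p \<in> \<Omega> \<Longrightarrow> pullback_factor f p (contact_factor f p)"
    "p \<in> \<Omega> \<Longrightarrow> 0 < contact_factor f p"
proof -
  show *: "open \<Omega>" "open \<Omega>'" "bij_betw f \<Omega> \<Omega>'" "C2_on f \<Omega>" "C1_on f \<Omega>" "C1_on (inv_into \<Omega> f) \<Omega>'"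
    "p \<in> \<Omega> \<Longrightarrow> 0 < contact_factor f p"
    using assms unfolding C2_contact_qc_def contact_transformation_def diffeo_on_def orientation_preserving_def by auto
  show "f differentiable at p" if "p \<in> \<Omega>"
    using C1_on_imp_has_derivative[OF *(5) that] differentiableI by blast
  show "pullback_factor f p (contact_factor f p)" if p: "p \<in> \<Omega>"
  proof -
    obtain l where l: "pullback_factor f p l"
      using assms p unfolding C2_contact_qc_def contact_transformation_def by blast
    have "contact_form p (axis 3 1) = 1"
      by (simp add: contact_form_def axis_def)
    then have "l' = l''" if "pullback_factor f p l'" "pullback_factor f p l''" for l' l''
      using that unfolding pullback_factor_def by (metis mult.right_neutral)
    then show ?thesis unfolding contact_factor_def by (metis l theI)
  qed
qed

lemma contact_factor_eq:
  assumes "C2_contact_qc f \<Omega> \<Omega>'" "p \<in> \<Omega>"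
  shows "contact_factor f p = contact_form (f p) (frechet_derivative f (at p) (axis 3 1))"
  using C2_contact_qcD(8)[OF assms] by (simp add: pullback_factor_def contact_form_def[of p] axis_def)

lemma frechet_derivative_horizontal_part:
  assumes "f differentiable at p"
  shows "frechet_derivative (horizontal_part f) (at p) v =
    Complex (frechet_derivative f (at p) v $ 1) (frechet_derivative f (at p) v $ 2)"
proof -
  let ?D = "frechet_derivative f (at p)"
  have f: "(f has_derivative ?D) (at p)" using assms frechet_derivative_works by blast
  have c: "((\<lambda>q. f q $ i) has_derivative (\<lambda>v. ?D v $ i)) (at p)" for i
    using f has_derivative_compose[OF f bounded_linear_imp_has_derivative[OF bounded_linear_vec_nth]] by simp
  have "((\<lambda>q. of_real (f q $ 1) + \<i> * of_real (f q $ 2)) has_derivative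
      (\<lambda>v. of_real (?D v $ 1) + \<i> * of_real (?D v $ 2))) (at p)"
    by (intro has_derivative_add has_derivative_mult_right has_derivative_of_real c)
  then have "(horizontal_part f has_derivative (\<lambda>v. Complex (?D v $ 1) (?D v $ 2))) (at p)"
    unfolding horizontal_part_def Complex_eq .
  from fun_cong[OF frechet_derivative_at[OF this], symmetric] show ?thesis .
qed

lemma continuous_on_Z_op:
  assumes "C2_contact_qc f \<Omega> \<Omega>'"
  shows "continuous_on \<Omega> (contact_factor f)" "continuous_on \<Omega> (Z_op (horizontal_part f))"
    "continuous_on \<Omega> (Zbar_op (horizontal_part f))"
proof -
  note D = C2_contact_qcD[OF assms]
  have f: "continuous_on \<Omega> f" using C1_on_imp_continuous_on[OF D(5)] .
  note d = C1_on_imp_continuous_frechet[OF D(5)]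
  have X: "continuous_on \<Omega> X_field" "continuous_on \<Omega> Y_field"
    unfolding X_field_axis[abs_def] Y_field_axis[abs_def] by (intro continuous_intros)+
  have "continuous_on \<Omega> (\<lambda>p. contact_form (f p) (frechet_derivative f (at p) (axis 3 1)))"
    unfolding contact_form_def by (intro continuous_intros f d)
  then show "continuous_on \<Omega> (contact_factor f)"
    by (rule continuous_on_eq) (simp add: contact_factor_eq[OF assms])
  have c: "continuous_on \<Omega> (\<lambda>p. frechet_derivative (horizontal_part f) (at p) (v p))" if "continuous_on \<Omega> v" for v
  proof -
    have "continuous_on \<Omega> (\<lambda>p. Complex (frechet_derivative f (at p) (v p) $ 1) (frechet_derivative f (at p) (v p) $ 2))"
      unfolding Complex_eq by (intro continuous_intros d that)
    then show ?thesis
      by (rule continuous_on_eq) (simp add: frechet_derivative_horizontal_part[OF D(7)])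
  qed
  let ?X = "\<lambda>p. frechet_derivative (horizontal_part f) (at p) (X_field p)"
  let ?Y = "\<lambda>p. frechet_derivative (horizontal_part f) (at p) (Y_field p)"
  have iY: "continuous_on \<Omega> (\<lambda>p. \<i> * ?Y p)"
    by (rule continuous_on_mult_left) (rule c, rule X)
  have "continuous_on \<Omega> (\<lambda>p. ?X p - \<i> * ?Y p)"
    by (rule continuous_on_diff) (rule c, rule X, rule iY)
  then have "continuous_on \<Omega> (\<lambda>p. (?X p - \<i> * ?Y p) / 2)"
    by (rule continuous_on_divide) simp_all
  then show "continuous_on \<Omega> (Z_op (horizontal_part f))"
    unfolding Z_op_def[abs_def] .
  have "continuous_on \<Omega> (\<lambda>p. ?X p + \<i> * ?Y p)"
    by (rule continuous_on_add) (rule c, rule X, rule iY)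
  then have "continuous_on \<Omega> (\<lambda>p. (?X p + \<i> * ?Y p) / 2)"
    by (rule continuous_on_divide) simp_all
  then show "continuous_on \<Omega> (Zbar_op (horizontal_part f))"
    unfolding Zbar_op_def[abs_def] .
qed

text \<open>
  This is \<open>d(f\<^sup>*\<omega>) = d(\<lambda> \<omega>) = d\<lambda> \<and> \<omega> + \<lambda> d\<omega>\<close> evaluated on \<open>X\<close> and \<open>Y\<close>: \<open>d\<omega>\<close> is four times the area form
  of the first two coordinates, and \<open>\<omega>\<close> vanishes on \<open>X\<close> and \<open>Y\<close>, which removes \<open>d\<lambda>\<close>. The exterior derivative
  is written as the antisymmetric part of the derivative of \<open>q \<mapsto> (f\<^sup>*\<omega>)\<^sub>q v\<close> for constant vectors \<open>v\<close>; the
  second derivatives of \<open>f\<close> cancel by symmetry.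
\<close>

lemma horizontal_det_eq_contact_factor:
  assumes f: "C2_contact_qc f \<Omega> \<Omega>'" and p: "p \<in> \<Omega>"
  defines "D \<equiv> frechet_derivative f (at p)"
  shows "D (X_field p) $ 1 * D (Y_field p) $ 2 - D (X_field p) $ 2 * D (Y_field p) $ 1 = contact_factor f p"
proof -
  note d = C2_contact_qcD[OF f]
  obtain f' :: "heis \<Rightarrow> heis \<Rightarrow>\<^sub>L heis" where f': "\<And>x. x \<in> \<Omega> \<Longrightarrow> (f has_derivative blinfun_apply (f' x)) (at x)"
    and f'1: "C1_on f' \<Omega>" by (rule C2_onE[OF d(4)]) (rule that)
  obtain f'' where f'': "(f' has_derivative f'') (at p)"
    using C1_on_imp_has_derivative[OF f'1 p] ..
  have D: "D = blinfun_apply (f' p)" unfolding D_def using frechet_derivative_at[OF f'[OF p]] by simp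
  have l: "contact_factor f p = contact_form (f p) (blinfun_apply (f' p) (axis 3 1))"
    using contact_factor_eq[OF f p] by (simp only: D[unfolded D_def])
  have sym: "blinfun_apply (f'' v) w = blinfun_apply (f'' w) v" for v w
    by (rule symmetric_second_derivative[OF d(1) p f' f''])
  have pb: "contact_form (f q) (blinfun_apply (f' q) v) =
      contact_form (f q) (blinfun_apply (f' q) (axis 3 1)) * contact_form q v" if "q \<in> \<Omega>" for q v
    using d(8)[OF that]
    unfolding pullback_factor_def contact_factor_eq[OF f that] frechet_derivative_at[OF f'[OF that], symmetric]
    by (rule spec)
  have f'v: "((\<lambda>q. blinfun_apply (f' q) v $ i) has_derivative (\<lambda>h. blinfun_apply (f'' h) v $ i)) (at p)" for v i
  proof -
    have "((\<lambda>q. blinfun_apply (f' q) v) has_derivative (\<lambda>h. blinfun_apply (f'' h) v)) (at p)"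
      using bounded_bilinear.FDERIV[OF bounded_bilinear_blinfun_apply f'' has_derivative_const[of v]]
      by simp
    from has_derivative_compose[OF this bounded_linear_imp_has_derivative[OF bounded_linear_vec_nth]]
    show ?thesis by simp
  qed
  have fi: "((\<lambda>q. f q $ i) has_derivative (\<lambda>h. D h $ i)) (at p)" for i
    using has_derivative_compose[OF f'[OF p] bounded_linear_imp_has_derivative[OF bounded_linear_vec_nth]]
    unfolding D by simp
  have nth: "((\<lambda>q::heis. q $ i) has_derivative (\<lambda>h. h $ i)) (at p)" for i
    by (rule bounded_linear_imp_has_derivative[OF bounded_linear_vec_nth])
  \<comment> \<open>The derivative in direction \<open>h\<close> of \<open>q \<mapsto> (f\<^sup>*\<omega>)\<^sub>q v\<close> at \<open>p\<close>.\<close>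
  define B where "B v h = blinfun_apply (f'' h) v $ 3 + 2 * f p $ 1 * blinfun_apply (f'' h) v $ 2
     - 2 * f p $ 2 * blinfun_apply (f'' h) v $ 1 + 2 * D h $ 1 * D v $ 2 - 2 * D h $ 2 * D v $ 1" for v h
  have A: "((\<lambda>q. contact_form (f q) (blinfun_apply (f' q) v)) has_derivative B v) (at p)" for v
    unfolding contact_form_def B_def[abs_def] D
    by (rule derivative_eq_intros f'v fi[unfolded D] refl)+ (auto simp: fun_eq_iff algebra_simps)
  have "((\<lambda>q. contact_form q v) has_derivative (\<lambda>h. 2 * h $ 1 * v $ 2 - 2 * h $ 2 * v $ 1)) (at p)" for v
    unfolding contact_form_def
    by (rule derivative_eq_intros nth refl)+ (auto simp: fun_eq_iff algebra_simps)
  from has_derivative_mult[OF A[of "axis 3 1"] this]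
  have R: "((\<lambda>q. contact_form (f q) (blinfun_apply (f' q) (axis 3 1)) * contact_form q v) has_derivative
     (\<lambda>h. contact_factor f p * (2 * h $ 1 * v $ 2 - 2 * h $ 2 * v $ 1) + B (axis 3 1) h * contact_form p v)) (at p)" for v
    unfolding l .
  have "((\<lambda>q. contact_form (f q) (blinfun_apply (f' q) v)) has_derivative
     (\<lambda>h. contact_factor f p * (2 * h $ 1 * v $ 2 - 2 * h $ 2 * v $ 1) + B (axis 3 1) h * contact_form p v)) (at p)" for v
    by (rule has_derivative_transform_within_open[OF R d(1) p]) (rule pb[symmetric])
  from fun_cong[OF has_derivative_unique[OF A this]]
  have "B v h = contact_factor f p * (2 * h $ 1 * v $ 2 - 2 * h $ 2 * v $ 1) + B (axis 3 1) h * contact_form p v" for v h .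
  \<comment> \<open>Antisymmetrising in \<open>X\<close> and \<open>Y\<close> leaves four times the claim.\<close>
  from this[of "X_field p" "Y_field p"] this[of "Y_field p" "X_field p"]
  show ?thesis
    unfolding B_def sym[of "X_field p" "Y_field p"]
    by (simp add: X_field_def Y_field_def contact_form_def algebra_simps)
qed

lemma cmod_square_difference_eq_det:
  fixes a b :: complex
  shows "(cmod ((a - \<i> * b) / 2))\<^sup>2 - (cmod ((a + \<i> * b) / 2))\<^sup>2 = Re a * Im b - Im a * Re b"
  by (simp add: norm_divide power_divide cmod_power2) (simp add: power2_eq_square field_simps)

lemma contact_factor_eq_Z:
  assumes "C2_contact_qc f \<Omega> \<Omega>'" "p \<in> \<Omega>"
  shows "contact_factor f p = (cmod (Z_op (horizontal_part f) p))\<^sup>2 - (cmod (Zbar_op (horizontal_part f) p))\<^sup>2"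
  unfolding Z_op_def Zbar_op_def cmod_square_difference_eq_det
  using horizontal_det_eq_contact_factor[OF assms]
  by (simp add: frechet_derivative_horizontal_part[OF C2_contact_qcD(7)[OF assms]])

lemma Z_op_dominates:
  assumes "C2_contact_qc f \<Omega> \<Omega>'" "p \<in> \<Omega>"
  shows "cmod (Zbar_op (horizontal_part f) p) < cmod (Z_op (horizontal_part f) p)"
  using C2_contact_qcD(9)[OF assms] contact_factor_eq_Z[OF assms]
  by (simp add: power2_less_imp_less)

text \<open>
  In the frames \<open>X, Y, \<partial>\<^sub>t\<close> at \<open>p\<close> and at \<open>f p\<close>, the differential is block triangular, with the block of
  \<open>horizontal_det_eq_contact_factor\<close> of determinant \<open>\<lambda>\<close> and the diagonal entry \<open>\<lambda>\<close>; both changes of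
  frame have determinant one.
\<close>

lemma det_frechet_derivative_contact:
  assumes f: "C2_contact_qc f \<Omega> \<Omega>'" and p: "p \<in> \<Omega>"
  shows "det (matrix (frechet_derivative f (at p))) = (contact_factor f p)\<^sup>2"
proof -
  define D where "D = frechet_derivative f (at p)"
  define l where "l = contact_factor f p"
  have pb: "contact_form (f p) (D v) = l * contact_form p v" for v
    using C2_contact_qcD(8)[OF f p] by (simp add: pullback_factor_def D_def l_def)
  have hd: "D (X_field p) $ 1 * D (Y_field p) $ 2 - D (X_field p) $ 2 * D (Y_field p) $ 1 = l"
    using horizontal_det_eq_contact_factor[OF f p] by (simp add: D_def l_def)
  interpret D: linear D
    unfolding D_def using C1_on_imp_has_derivative[OF C2_contact_qcD(5)[OF f] p] has_derivative_linear by blast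
  define m where "m i j = D (axis j 1) $ i" for i j
  have DX: "D (X_field p) $ i = m i 1 + 2 * p $ 2 * m i 3" and DY: "D (Y_field p) $ i = m i 2 - 2 * p $ 1 * m i 3" for i
    unfolding X_field_axis Y_field_axis m_def by (simp_all add: D.add D.diff D.scale)
  define a where "a = 2 * f p $ 1"
  define b where "b = 2 * f p $ 2"
  define c where "c = 2 * p $ 1"
  define e where "e = 2 * p $ 2"
  have "m 3 1 + a * m 2 1 - b * m 1 1 = - l * e"
    "m 3 2 + a * m 2 2 - b * m 1 2 = l * c"
    "m 3 3 + a * m 2 3 - b * m 1 3 = l"
    using pb[of "axis 1 1"] pb[of "axis 2 1"] pb[of "axis 3 1"]
    by (simp_all add: contact_form_def m_def axis_def a_def b_def c_def e_def)
  then have r: "m 3 1 = b * m 1 1 - a * m 2 1 - l * e" "m 3 2 = b * m 1 2 - a * m 2 2 + l * c"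
    "m 3 3 = b * m 1 3 - a * m 2 3 + l" by simp_all
  have h: "(m 1 1 + e * m 1 3) * (m 2 2 - c * m 2 3) - (m 2 1 + e * m 2 3) * (m 1 2 - c * m 1 3) = l"
    using hd unfolding DX DY c_def e_def .
  have "det (matrix D) = m 1 1 * m 2 2 * m 3 3 + m 1 2 * m 2 3 * m 3 1 + m 1 3 * m 2 1 * m 3 2
      - m 1 1 * m 2 3 * m 3 2 - m 1 2 * m 2 1 * m 3 3 - m 1 3 * m 2 2 * m 3 1"
    by (simp add: det_3 matrix_def m_def)
  also have "\<dots> = l * ((m 1 1 + e * m 1 3) * (m 2 2 - c * m 2 3) - (m 2 1 + e * m 2 3) * (m 1 2 - c * m 1 3))"
    unfolding r by (simp add: algebra_simps)
  also have "\<dots> = l\<^sup>2" unfolding h by (simp add: power2_eq_square)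
  finally show ?thesis unfolding D_def l_def .
qed

definition area_stretch :: "(heis \<Rightarrow> heis) \<Rightarrow> heis \<Rightarrow> real" where
  "area_stretch f p = contact_factor f p *
     (cmod (Z_op (horizontal_part f) p) - cmod (Zbar_op (horizontal_part f) p))"

lemma area_stretch_pos:
  assumes "C2_contact_qc f \<Omega> \<Omega>'" "p \<in> \<Omega>"
  shows "0 < area_stretch f p"
  using C2_contact_qcD(9)[OF assms] Z_op_dominates[OF assms] by (simp add: area_stretch_def)

lemma continuous_on_area_stretch:
  assumes "C2_contact_qc f \<Omega> \<Omega>'"
  shows "continuous_on \<Omega> (area_stretch f)"
  unfolding area_stretch_def[abs_def] by (intro continuous_intros continuous_on_Z_op[OF assms])

lemma continuous_on_distortion:
  assumes "C2_contact_qc f \<Omega> \<Omega>'"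
  shows "continuous_on \<Omega> (distortion f)"
  unfolding distortion_def[abs_def] using Z_op_dominates[OF assms]
  by (intro continuous_intros continuous_on_Z_op[OF assms]) force

text \<open>
  With \<open>a = \<bar>Z f\<^sub>I\<bar>\<close>, \<open>b = \<bar>W f\<^sub>I\<bar>\<close> (\<open>W\<close> the conjugate of \<open>Z\<close>) and \<open>\<lambda> = (a + b) (a - b)\<close>,
  the quantity under the exponent \<open>2/3\<close> is
  \<open>(a + b) / (a - b) \<cdot> (\<lambda> (a - b))\<^sup>2 = \<lambda>\<^sup>3\<close>.
\<close>

lemma distortion_powr_area_stretch:
  assumes "C2_contact_qc f \<Omega> \<Omega>'" "p \<in> \<Omega>"
  shows "distortion f p powr (2/3) * area_stretch f p powr (4/3) = (contact_factor f p)\<^sup>2"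
proof -
  define a where "a = cmod (Z_op (horizontal_part f) p)"
  define b where "b = cmod (Zbar_op (horizontal_part f) p)"
  define l where "l = contact_factor f p"
  have ab: "0 < a - b" "0 < a + b" using Z_op_dominates[OF assms] norm_ge_zero[of "Zbar_op (horizontal_part f) p"] unfolding a_def b_def by linarith+
  have l: "l = (a + b) * (a - b)" using contact_factor_eq_Z[OF assms]
    by (simp add: a_def b_def l_def power2_eq_square algebra_simps)
  have l0: "0 < l" using ab l by simp
  have "distortion f p powr (2/3) * area_stretch f p powr (4/3)
      = ((a + b) / (a - b)) powr (2/3) * ((l * (a - b)) powr 2) powr (2/3)"
    by (simp add: distortion_def area_stretch_def a_def b_def l_def powr_powr)
  also have "\<dots> = ((a + b) / (a - b) * (l * (a - b))\<^sup>2) powr (2/3)"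
    using ab l0 by (subst powr_mult[symmetric]) (auto simp: powr_numeral)
  also have "(a + b) / (a - b) * (l * (a - b))\<^sup>2 = l * l\<^sup>2"
    using ab by (simp add: l power2_eq_square)
  also have "\<dots> = l powr 3" using l0 by (simp add: powr_numeral power3_eq_cube power2_eq_square)
  also have "(l powr 3) powr (2/3) = l\<^sup>2" using powr_powr[of l 3 "2/3"] l0 by simp
  finally show ?thesis by (simp add: l_def)
qed

lemma hnorm_eq_cmod: "hnorm v = cmod (Complex (v $ 1) (v $ 2))"
  by (simp add: hnorm_def complex_norm)

lemma real_combination_eq_Z_combination:
  "of_real a * A + of_real b * B = Complex a b * ((A - \<i> * B) / 2) + cnj (Complex a b) * ((A + \<i> * B) / 2)"
proof -
  have "2 * (of_real a * A + of_real b * B)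
      = Complex a b * (A - \<i> * B) + cnj (Complex a b) * (A + \<i> * B)"
    by (simp add: complex_eq_iff algebra_simps)
  then have "(2 * (of_real a * A + of_real b * B)) / 2
      = (Complex a b * (A - \<i> * B) + cnj (Complex a b) * (A + \<i> * B)) / 2" by (rule arg_cong)
  then show ?thesis by (simp add: add_divide_distrib)
qed

text \<open>
  On the horizontal plane, identified with the complex numbers, the differential acts as
  \<open>z \<mapsto> z Z f\<^sub>I + z\<^sup>* W f\<^sub>I\<close> with \<open>W\<close> the conjugate of the operator \<open>Z\<close> and
  \<open>z\<^sup>*\<close> the conjugate of \<open>z\<close>; so the bound is the reverse triangle inequality.
\<close>

lemma hnorm_frechet_derivative_ge:
  assumes f: "C2_contact_qc f \<Omega> \<Omega>'" and p: "p \<in> \<Omega>" and h: "contact_form p h = 0"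
  shows "(cmod (Z_op (horizontal_part f) p) - cmod (Zbar_op (horizontal_part f) p)) * hnorm h
     \<le> hnorm (frechet_derivative f (at p) h)"
proof -
  let ?Z = "Z_op (horizontal_part f) p" and ?W = "Zbar_op (horizontal_part f) p"
  define D where "D = frechet_derivative f (at p)"
  define z where "z = Complex (h $ 1) (h $ 2)"
  interpret D: linear D
    unfolding D_def using C1_on_imp_has_derivative[OF C2_contact_qcD(5)[OF f] p] has_derivative_linear by blast
  have hXY: "h = (h $ 1) *\<^sub>R X_field p + (h $ 2) *\<^sub>R Y_field p"
    using h by (simp add: X_field_def Y_field_def vec_eq_iff forall_3 contact_form_def algebra_simps)
  have "D h = (h $ 1) *\<^sub>R D (X_field p) + (h $ 2) *\<^sub>R D (Y_field p)"
    by (subst hXY) (simp only: D.add D.scale)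
  then have "Complex (D h $ 1) (D h $ 2)
      = of_real (h $ 1) * Complex (D (X_field p) $ 1) (D (X_field p) $ 2)
        + of_real (h $ 2) * Complex (D (Y_field p) $ 1) (D (Y_field p) $ 2)"
    by (simp add: complex_eq_iff)
  also have "\<dots> = z * ?Z + cnj z * ?W"
    unfolding z_def Z_op_def Zbar_op_def frechet_derivative_horizontal_part[OF C2_contact_qcD(7)[OF f p]] D_def[symmetric]
    by (rule real_combination_eq_Z_combination)
  finally have "Complex (D h $ 1) (D h $ 2) = z * ?Z + cnj z * ?W" .
  then have "hnorm (D h) = cmod (z * ?Z + cnj z * ?W)"
    by (simp only: hnorm_eq_cmod)
  also have "cmod (z * ?Z) - cmod (cnj z * ?W) \<le> \<dots>"
    by (rule norm_diff_ineq)
  finally have "cmod z * cmod ?Z - cmod z * cmod ?W \<le> hnorm (D h)"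
    by (simp add: norm_mult)
  moreover have "hnorm h = cmod z" by (simp only: z_def hnorm_eq_cmod)
  ultimately show ?thesis by (simp add: D_def algebra_simps)
qed

section \<open>Change of variables for non-negative functions\<close>

text \<open>
  Reduces an equation between two integrals, either of which may be infinite, to statements about
  finite values, which is all that integrability theorems speak about.
\<close>

lemma ennreal_eqI_finite:
  fixes a b :: ennreal
  assumes "\<And>r. 0 \<le> r \<Longrightarrow> a = ennreal r \<longleftrightarrow> b = ennreal r"
  shows "a = b"
proof (cases a)
  case (real r)
  then show ?thesis using assms[of r] by simp
next
  case top
  show ?thesis
  proof (cases b)
    case (real r)
    then show ?thesis using assms[of r] by simp
  qed (use top in simp)
qed

lemma has_integral_iff_set_nn_integral:
  fixes f :: "'a::euclidean_space \<Rightarrow> real"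
  assumes "\<And>x. x \<in> S \<Longrightarrow> 0 \<le> f x" "(\<lambda>x. indicator S x * f x) \<in> borel_measurable lebesgue" "0 \<le> r"
  shows "(f has_integral r) S \<longleftrightarrow> (\<integral>\<^sup>+x\<in>S. ennreal (f x) \<partial>lborel) = ennreal r"
proof -
  have eq: "(\<lambda>x. if x \<in> S then f x else 0) = (\<lambda>x. indicator S x * f x)"
    by (auto simp: fun_eq_iff indicator_def)
  have "(f has_integral r) S \<longleftrightarrow> ((\<lambda>x. indicator S x * f x) has_integral r) UNIV"
    using has_integral_restrict_UNIV[of S f r] by (simp add: eq)
  also have "\<dots> \<longleftrightarrow> (\<integral>\<^sup>+x. ennreal (indicator S x * f x) \<partial>lebesgue) = ennreal r"
    using assms by (subst has_integral_iff_nn_integral_lebesgue) (auto simp: indicator_def)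
  also have "(\<integral>\<^sup>+x. ennreal (indicator S x * f x) \<partial>lebesgue) = (\<integral>\<^sup>+x\<in>S. ennreal (f x) \<partial>lborel)"
    unfolding nn_integral_completion by (intro nn_integral_cong) (auto simp: indicator_def)
  finally show ?thesis .
qed

text \<open>
  Transfer of the theorem on absolutely integrable functions: since \<open>f\<close> is non-negative, each side has the
  finite value \<open>r\<close> exactly if the corresponding gauge integral exists and is \<open>r\<close>. That theorem
  requires values in a Cartesian power of the reals, hence the detour through \<open>real^1\<close>.
\<close>

lemma nn_integral_change_of_variables:
  fixes g :: "real^'m::{finite,wellorder} \<Rightarrow> real^'m::_" and f :: "real^'m::{finite,wellorder} \<Rightarrow> real"
  assumes S: "S \<in> sets borel" and gS: "g ` S \<in> sets borel"
    and der: "\<And>x. x \<in> S \<Longrightarrow> (g has_derivative g' x) (at x)"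
    and inj: "inj_on g S"
    and f: "f \<in> borel_measurable borel" "\<And>y. 0 \<le> f y"
  shows "(\<integral>\<^sup>+y\<in>g ` S. ennreal (f y) \<partial>lborel) = (\<integral>\<^sup>+x\<in>S. ennreal (\<bar>det (matrix (g' x))\<bar> * f (g x)) \<partial>lborel)"
proof (rule ennreal_eqI_finite)
  fix r :: real assume r: "0 \<le> r"
  have SL: "S \<in> sets lebesgue" using S by simp
  have der': "(g has_derivative g' x) (at x within S)" if "x \<in> S" for x
    using der[OF that] has_derivative_at_withinI by blast
  have cont: "continuous_on S g"
    using der' has_derivative_continuous_on by blast
  have m1: "(\<lambda>y. indicator (g ` S) y * f y) \<in> borel_measurable lebesgue"
    using gS f by (intro measurable_completion) auto
  have fg: "(\<lambda>x. f (g x)) \<in> borel_measurable (lebesgue_on S)"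
    using measurable_compose[OF continuous_imp_measurable_on_sets_lebesgue[OF cont SL] f(1)] by simp
  have m2': "(\<lambda>x. \<bar>det (matrix (g' x))\<bar> * f (g x)) \<in> borel_measurable (lebesgue_on S)"
    using borel_measurable_det_Jacobian[OF SL der'] fg by measurable
  then have m2: "(\<lambda>x. indicator S x * (\<bar>det (matrix (g' x))\<bar> * f (g x))) \<in> borel_measurable lebesgue"
    using SL borel_measurable_restrict_space_iff[of S lebesgue "\<lambda>x. \<bar>det (matrix (g' x))\<bar> * f (g x)"] by simp
  have one: "(\<lambda>x. vec (h x) :: real^1) absolutely_integrable_on T \<and> integral T (\<lambda>x. vec (h x) :: real^1) = vec r
      \<longleftrightarrow> (h has_integral r) T" if "\<And>x. x \<in> T \<Longrightarrow> 0 \<le> h x" for h :: "real^'m::{finite,wellorder} \<Rightarrow> real" and T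
    unfolding absolutely_integrable_on_1_iff integral_on_1_eq
    using absolutely_integrable_on_iff_nonneg[of T h] that
    by (auto simp: has_integral_iff vec_eq_iff)
  have v: "\<bar>d\<bar> *\<^sub>R (vec a :: real^1) = vec (\<bar>d\<bar> * a)" for d a by (simp add: vec_eq_iff)
  have "(f has_integral r) (g ` S) \<longleftrightarrow> ((\<lambda>x. \<bar>det (matrix (g' x))\<bar> * f (g x)) has_integral r) S"
    using has_absolute_integral_change_of_variables[OF SL der' inj, of "\<lambda>y. vec (f y) :: real^1" "vec r"]
    unfolding v one[OF f(2)] one[OF mult_nonneg_nonneg[OF abs_ge_zero f(2)]] ..
  moreover have "(f has_integral r) (g ` S) \<longleftrightarrow> (\<integral>\<^sup>+y\<in>g ` S. ennreal (f y) \<partial>lborel) = ennreal r"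
    using f(2) by (intro has_integral_iff_set_nn_integral m1 r)
  moreover have "((\<lambda>x. \<bar>det (matrix (g' x))\<bar> * f (g x)) has_integral r) S \<longleftrightarrow>
      (\<integral>\<^sup>+x\<in>S. ennreal (\<bar>det (matrix (g' x))\<bar> * f (g x)) \<partial>lborel) = ennreal r"
    using f(2) by (intro has_integral_iff_set_nn_integral m2 r mult_nonneg_nonneg) auto
  ultimately show "(\<integral>\<^sup>+y\<in>g ` S. ennreal (f y) \<partial>lborel) = ennreal r \<longleftrightarrow>
      (\<integral>\<^sup>+x\<in>S. ennreal (\<bar>det (matrix (g' x))\<bar> * f (g x)) \<partial>lborel) = ennreal r"
    by (simp only:)
qed

section \<open>Horizontal area in surface patches\<close>

text \<open>
  The tangent vector \<open>\<omega>(\<sigma>\<^sub>v) \<sigma>\<^sub>u - \<omega>(\<sigma>\<^sub>u) \<sigma>\<^sub>v\<close>: for an immersion it vanishes where the tangent plane is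
  horizontal, and elsewhere it spans the intersection of the two planes, which is the direction of
  the characteristic foliation. Unlike the horizontal normal it is carried along
  by differentials up to a scalar factor, both under reparametrisation and under contact
  transformations.
\<close>

definition characteristic_direction :: "(real^2 \<Rightarrow> heis) \<Rightarrow> real^2 \<Rightarrow> heis" where
  "characteristic_direction \<sigma> w =
     (let \<sigma>u = frechet_derivative \<sigma> (at w) (axis 1 1);
          \<sigma>v = frechet_derivative \<sigma> (at w) (axis 2 1)
      in contact_form (\<sigma> w) \<sigma>v *\<^sub>R \<sigma>u - contact_form (\<sigma> w) \<sigma>u *\<^sub>R \<sigma>v)"

lemma contact_form_linear: "linear (contact_form p)"
  by (intro linearI) (simp_all add: contact_form_def algebra_simps)

lemma contact_form_characteristic_direction: "contact_form (\<sigma> w) (characteristic_direction \<sigma> w) = 0"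
  unfolding characteristic_direction_def Let_def
  by (simp add: linear_diff[OF contact_form_linear] linear_scale[OF contact_form_linear])

lemma hnorm_scaleR: "hnorm (c *\<^sub>R v) = \<bar>c\<bar> * hnorm v"
  unfolding hnorm_def
  by (simp add: power_mult_distrib real_sqrt_mult flip: distrib_left)

lemma hnorm_nonneg [simp]: "0 \<le> hnorm v"
  by (simp add: hnorm_def)

text \<open>
  In the frame \<open>X, Y\<close> the two vectors differ by a rotation through a right angle.
\<close>

lemma hnorm_horizontal_normal: "hnorm (horizontal_normal \<sigma> w) = hnorm (characteristic_direction \<sigma> w)"
proof -
  have "horizontal_normal \<sigma> w $ 1 = characteristic_direction \<sigma> w $ 2"
    "horizontal_normal \<sigma> w $ 2 = - characteristic_direction \<sigma> w $ 1"
    unfolding horizontal_normal_def jac_def characteristic_direction_def Let_def contact_form_def X_field_def Y_field_def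
    by (simp_all add: algebra_simps)
  then show ?thesis by (simp add: hnorm_def add.commute)
qed

lemma hnorm_horizontal_normal_eq_0_iff: "hnorm (horizontal_normal \<sigma> w) = 0 \<longleftrightarrow> horizontal_normal \<sigma> w = 0"
  unfolding hnorm_def horizontal_normal_def X_field_def Y_field_def
  by (auto simp: vec_eq_iff forall_3 sum_power2_eq_zero_iff)

text \<open>
  The characteristic direction is alternating bilinear in \<open>\<sigma>\<^sub>u\<close> and \<open>\<sigma>\<^sub>v\<close>, so a change of parameters
  multiplies it by the Jacobian determinant.
\<close>

lemma characteristic_direction_reparametrize:
  assumes s: "(\<sigma>' has_derivative frechet_derivative \<sigma>' (at (\<phi> w))) (at (\<phi> w))"
    and phi: "(\<phi> has_derivative \<phi>') (at w)"
    and W: "open W" "w \<in> W" "\<And>x. x \<in> W \<Longrightarrow> \<sigma> x = \<sigma>' (\<phi> x)"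
  shows "characteristic_direction \<sigma> w = det (matrix \<phi>') *\<^sub>R characteristic_direction \<sigma>' (\<phi> w)"
proof -
  let ?D' = "frechet_derivative \<sigma>' (at (\<phi> w))"
  interpret D': linear ?D' using s has_derivative_linear by blast
  have "((\<lambda>x. \<sigma>' (\<phi> x)) has_derivative (\<lambda>h. ?D' (\<phi>' h))) (at w)"
    using has_derivative_compose[OF phi s] .
  then have "(\<sigma> has_derivative (\<lambda>h. ?D' (\<phi>' h))) (at w)"
    by (rule has_derivative_transform_within_open[OF _ W(1,2)]) (simp add: W(3))
  then have D: "frechet_derivative \<sigma> (at w) h = ?D' (\<phi>' h)" for h
    using fun_cong[OF frechet_derivative_at] by metis
  define m where "m i j = \<phi>' (axis j 1) $ i" for i j :: 2
  have "x = x $ 1 *\<^sub>R axis 1 1 + x $ 2 *\<^sub>R axis 2 1" for x :: "real^2"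
    by (simp add: vec_eq_iff forall_2 axis_def)
  then have e: "\<phi>' (axis j 1) = m 1 j *\<^sub>R axis 1 1 + m 2 j *\<^sub>R axis 2 1" for j
    unfolding m_def by metis
  have d: "frechet_derivative \<sigma> (at w) (axis j 1) = m 1 j *\<^sub>R ?D' (axis 1 1) + m 2 j *\<^sub>R ?D' (axis 2 1)" for j
    unfolding D e D'.add D'.scale ..
  have det: "det (matrix \<phi>') = m 1 1 * m 2 2 - m 1 2 * m 2 1"
    by (simp add: det_2 matrix_def m_def)
  show ?thesis
    unfolding det characteristic_direction_def Let_def d W(3)[OF W(2)]
      linear_add[OF contact_form_linear] linear_scale[OF contact_form_linear]
    by (simp add: algebra_simps)
qed

text \<open>
  A transition map between patches is only known to be continuous, and \<open>\<sigma>'\<close> is not a map between spaces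
  of equal dimension. Composing with a left inverse \<open>L\<close> of its derivative at the point repairs this: the
  inverse function theorem gives a local inverse \<open>g\<close> of \<open>L \<circ> \<sigma>'\<close>, and \<open>\<phi> = g \<circ> L \<circ> \<sigma>\<close> near \<open>w\<close>.
\<close>

lemma patch_transition_differentiable:
  fixes \<sigma> :: "'a::real_normed_vector \<Rightarrow> 'c::euclidean_space" and \<sigma>' :: "'b::euclidean_space \<Rightarrow> 'c"
  assumes W: "open W" "w \<in> W" and s: "\<sigma> differentiable at w"
    and U': "open U'" and s': "C1_on \<sigma>' U'" and inj: "inj (frechet_derivative \<sigma>' (at (\<phi> w)))"
    and phi: "continuous_on W \<phi>" "\<phi> ` W \<subseteq> U'" "\<And>x. x \<in> W \<Longrightarrow> \<sigma>' (\<phi> x) = \<sigma> x"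
  shows "\<phi> differentiable at w"
proof -
  obtain D where D: "\<And>x. x \<in> U' \<Longrightarrow> (\<sigma>' has_derivative blinfun_apply (D x)) (at x)" "continuous_on U' D"
    by (rule C1_onE[OF s']) (rule that)
  have pw: "\<phi> w \<in> U'" using W phi by blast
  have "inj (blinfun_apply (D (\<phi> w)))"
    using inj frechet_derivative_at[OF D(1)[OF pw]] by simp
  then obtain L where L: "linear L" "L \<circ> blinfun_apply (D (\<phi> w)) = id"
    using linear_injective_left_inverse[of "blinfun_apply (D (\<phi> w))"] blinfun.bounded_linear_right bounded_linear.linear by blast
  define Lb where "Lb = Blinfun L"
  have bl: "bounded_linear L" using L(1) linear_conv_bounded_linear by blast
  have Lb: "blinfun_apply Lb = L" unfolding Lb_def by (rule bounded_linear_Blinfun_apply[OF bl])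
  have der: "((\<lambda>x. L (\<sigma>' x)) has_derivative blinfun_apply (Lb o\<^sub>L D x)) (at x)" if "x \<in> U'" for x
    using bounded_linear.has_derivative[OF bl D(1)[OF that]] by (simp add: Lb blinfun_compose.rep_eq o_def)
  have cont: "continuous_on U' (\<lambda>x. Lb o\<^sub>L D x)"
    by (rule bounded_bilinear.continuous_on[OF bounded_bilinear_blinfun_compose continuous_on_const D(2)])
  have "id_blinfun o\<^sub>L (Lb o\<^sub>L D (\<phi> w)) = id_blinfun"
    by (rule blinfun_eqI) (use L(2) in \<open>simp add: Lb fun_eq_iff\<close>)
  from inverse_function_theorem[OF U' der cont pw this]
  obtain U'' V g g' where I: "open U''" "U'' \<subseteq> U'" "\<phi> w \<in> U''" "open V" "L (\<sigma>' (\<phi> w)) \<in> V"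
    "homeomorphism U'' V (\<lambda>x. L (\<sigma>' x)) g" "\<And>y. y \<in> V \<Longrightarrow> (g has_derivative (g' y)) (at y)"
    by metis
  define W' where "W' = W \<inter> \<phi> -` U''"
  have W': "open W'" "w \<in> W'"
    unfolding W'_def using continuous_open_preimage[OF phi(1) W(1) I(1)] I(3) W(2) by auto
  have eq: "g (L (\<sigma> x)) = \<phi> x" if "x \<in> W'" for x
    using that I(6) phi(3) unfolding W'_def homeomorphism_def by force
  obtain S where S: "(\<sigma> has_derivative S) (at w)" using s unfolding differentiable_def by blast
  have "((\<lambda>x. L (\<sigma> x)) has_derivative (\<lambda>h. L (S h))) (at w)"
    by (rule bounded_linear.has_derivative[OF bl S])
  moreover have "(g has_derivative g' (L (\<sigma> w))) (at (L (\<sigma> w)))"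
    using I(5,7) phi(3)[OF W(2)] by simp
  ultimately have "((\<lambda>x. g (L (\<sigma> x))) has_derivative (\<lambda>h. g' (L (\<sigma> w)) (L (S h)))) (at w)"
    by (rule has_derivative_compose)
  then have "(\<phi> has_derivative (\<lambda>h. g' (L (\<sigma> w)) (L (S h)))) (at w)"
    by (rule has_derivative_transform_within_open[OF _ W']) (rule eq)
  then show ?thesis unfolding differentiable_def by blast
qed

lemma regular_patchD:
  assumes "regular_patch \<sigma> U"
  shows "open U" "C1_on \<sigma> U" "continuous_on U \<sigma>" "inj_on \<sigma> U"
    "w \<in> U \<Longrightarrow> inj (frechet_derivative \<sigma> (at w))"
    "homeomorphism U (\<sigma> ` U) \<sigma> (inv_into U \<sigma>)"
proof -
  obtain g where g: "homeomorphism U (\<sigma> ` U) \<sigma> g" using assms unfolding regular_patch_def by blast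
  show *: "open U" "C1_on \<sigma> U" "continuous_on U \<sigma>" "w \<in> U \<Longrightarrow> inj (frechet_derivative \<sigma> (at w))"
    using assms g C2_on_imp_C1_on unfolding regular_patch_def homeomorphism_def by auto
  show inj: "inj_on \<sigma> U" using g unfolding homeomorphism_def by (metis inj_onI)
  have "g y = inv_into U \<sigma> y" if "y \<in> \<sigma> ` U" for y
    using that g inj unfolding homeomorphism_def by (metis image_eqI inv_into_f_eq)
  then show "homeomorphism U (\<sigma> ` U) \<sigma> (inv_into U \<sigma>)"
    using g by (rule_tac homeomorphism_cong[OF g]) auto
qed

lemma continuous_image_open_borel:
  fixes f :: "'a::euclidean_space \<Rightarrow> 'b::{t2_space}"
  assumes "open U" "continuous_on U f"
  shows "f ` U \<in> sets borel"
proof -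
  obtain C where C: "\<And>n::nat. compact (C n)" "\<And>n. C n \<subseteq> U" "\<Union>(range C) = U"
    using open_Union_compact_subsets[OF assms(1)] by metis
  have "f ` U = (\<Union>n. f ` C n)" using C(3) by blast
  also have "\<dots> \<in> sets borel"
    using C(1,2) assms(2) by (intro sets.countable_UN) (auto intro!: borel_closed compact_imp_closed
        compact_continuous_image intro: continuous_on_subset)
  finally show ?thesis .
qed

lemma continuous_hnorm_horizontal_normal:
  assumes "regular_patch \<sigma> U"
  shows "continuous_on U (\<lambda>w. hnorm (horizontal_normal \<sigma> w))"
proof -
  note p = regular_patchD[OF assms]
  have d: "continuous_on U (\<lambda>w. frechet_derivative \<sigma> (at w) v)" for v
    by (rule C1_on_imp_continuous_frechet[OF p(2) continuous_on_const])
  show ?thesis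
    unfolding hnorm_horizontal_normal unfolding hnorm_def characteristic_direction_def Let_def contact_form_def
    by (intro continuous_intros d p(3))
qed

text \<open>
  The measure \<open>\<parallel>N\<^sup>h\<parallel> du dv\<close> carried over to the ambient space. The parametrisation is set to \<open>0\<close> outside \<open>U\<close>
  only to make it Borel measurable; the density vanishes there.
\<close>

definition patch_measure :: "(real^2 \<Rightarrow> heis) \<Rightarrow> (real^2) set \<Rightarrow> heis measure" where
  "patch_measure \<sigma> U =
     distr (density lborel (\<lambda>w. ennreal (indicator U w *\<^sub>R hnorm (horizontal_normal \<sigma> w)))) borel
       (\<lambda>w. indicator U w *\<^sub>R \<sigma> w)"

lemma sets_patch_measure [simp, measurable_cong]: "sets (patch_measure \<sigma> U) = sets borel"
  by (simp add: patch_measure_def)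

lemma nn_integral_patch_measure:
  assumes "regular_patch \<sigma> U" "F \<in> borel_measurable borel"
  shows "(\<integral>\<^sup>+p. F p \<partial>patch_measure \<sigma> U) =
    (\<integral>\<^sup>+w\<in>U. F (\<sigma> w) * ennreal (hnorm (horizontal_normal \<sigma> w)) \<partial>lborel)"
proof -
  note p = regular_patchD[OF assms(1)]
  have U: "U \<in> sets borel" using p(1) by simp
  define d where "d w = indicator U w *\<^sub>R hnorm (horizontal_normal \<sigma> w)" for w
  define s where "s w = indicator U w *\<^sub>R \<sigma> w" for w
  have [measurable]: "d \<in> borel_measurable borel" unfolding d_def[abs_def]
    by (rule borel_measurable_continuous_on_indicator[OF U continuous_hnorm_horizontal_normal[OF assms(1)]])
  have [measurable]: "s \<in> borel_measurable borel" unfolding s_def[abs_def]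
    by (rule borel_measurable_continuous_on_indicator[OF U p(3)])
  note [measurable] = assms(2)
  have "(\<integral>\<^sup>+p. F p \<partial>patch_measure \<sigma> U) = (\<integral>\<^sup>+w. F (s w) \<partial>density lborel (\<lambda>w. ennreal (d w)))"
    unfolding patch_measure_def d_def[symmetric] s_def[symmetric] by (rule nn_integral_distr) measurable
  also have "\<dots> = (\<integral>\<^sup>+w. ennreal (d w) * F (s w) \<partial>lborel)"
    by (rule nn_integral_density) measurable
  also have "\<dots> = (\<integral>\<^sup>+w\<in>U. F (\<sigma> w) * ennreal (hnorm (horizontal_normal \<sigma> w)) \<partial>lborel)"
    by (intro nn_integral_cong) (auto simp: d_def s_def indicator_def mult.commute)
  finally show ?thesis .
qed

lemma emeasure_patch_measure:
  assumes "regular_patch \<sigma> U" "A \<in> sets borel"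
  shows "emeasure (patch_measure \<sigma> U) A =
    (\<integral>\<^sup>+w\<in>U. indicator A (\<sigma> w) * ennreal (hnorm (horizontal_normal \<sigma> w)) \<partial>lborel)"
  using nn_integral_patch_measure[OF assms(1), of "indicator A"] assms(2) by simp

text \<open>
  The transition map \<open>\<phi>\<close> is a differentiable bijection between the parts of the parameter domains lying
  over \<open>B\<close>, and its Jacobian is the ratio of the two area densities.
\<close>

lemma patch_measure_transition:
  assumes p: "patch_of S \<sigma> U" and p': "patch_of S \<sigma>' U'"
    and B: "B \<in> sets borel" "B \<subseteq> \<sigma> ` U" "B \<subseteq> \<sigma>' ` U'"
  shows "emeasure (patch_measure \<sigma> U) B = emeasure (patch_measure \<sigma>' U') B"
proof -
  have r: "regular_patch \<sigma> U" and r': "regular_patch \<sigma>' U'"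
    and op': "openin (top_of_set S) (\<sigma>' ` U')" and op: "openin (top_of_set S) (\<sigma> ` U)"
    using p p' unfolding patch_of_def by auto
  note P = regular_patchD[OF r] and P' = regular_patchD[OF r']
  define W where "W = U \<inter> \<sigma> -` (\<sigma>' ` U')"
  have "openin (top_of_set U) W" unfolding W_def
    by (rule continuous_openin_preimage[OF P(3) _ op']) (use openin_imp_subset[OF op] in auto)
  then have W: "open W" using P(1) openin_open_trans by blast
  define \<phi> where "\<phi> = (\<lambda>w. inv_into U' \<sigma>' (\<sigma> w))"
  have phi: "continuous_on W \<phi>" unfolding \<phi>_def
    by (rule continuous_on_compose2[of "\<sigma>' ` U'"])
       (use P'(6) P(3) in \<open>auto simp: homeomorphism_def W_def intro: continuous_on_subset\<close>)
  have phi2: "\<phi> x \<in> U'" "\<sigma>' (\<phi> x) = \<sigma> x" if "x \<in> W" for x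
    using that unfolding \<phi>_def W_def by (auto intro: inv_into_into f_inv_into_f)
  have phi': "(\<phi> has_derivative frechet_derivative \<phi> (at w)) (at w)" if "w \<in> W" for w
  proof -
    have "\<sigma> differentiable at w"
      using that C1_on_imp_has_derivative[OF P(2)] differentiableI unfolding W_def by blast
    then have "\<phi> differentiable at w"
      using that phi2 P'(5)
      by (intro patch_transition_differentiable[OF W that _ P'(1,2) _ phi]) auto
    then show ?thesis using frechet_derivative_works by blast
  qed
  define A where "A = U \<inter> \<sigma> -` B"
  have AW: "A \<subseteq> W" using B unfolding A_def W_def by blast
  have meas: "V \<inter> s -` B \<in> sets borel" if "regular_patch s V" for s V
  proof -
    have "s \<in> measurable (restrict_space borel V) borel"
      using borel_measurable_continuous_on_restrict[OF regular_patchD(3)[OF that]] .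
    from measurable_sets[OF this B(1)] show ?thesis
      using regular_patchD(1)[OF that] by (simp add: space_restrict_space sets_restrict_space_iff Int_commute)
  qed
  have Ab: "A \<in> sets borel" unfolding A_def by (rule meas[OF r])
  have img: "\<phi> ` A = U' \<inter> \<sigma>' -` B"
  proof
    show "\<phi> ` A \<subseteq> U' \<inter> \<sigma>' -` B" using phi2 AW unfolding A_def by auto
    show "U' \<inter> \<sigma>' -` B \<subseteq> \<phi> ` A"
    proof
      fix y assume y: "y \<in> U' \<inter> \<sigma>' -` B"
      then obtain x where x: "x \<in> U" "\<sigma> x = \<sigma>' y" using B(2) by (metis IntD2 imageE subsetD vimageE)
      then have "\<phi> x = y" using y P'(4) unfolding \<phi>_def by (simp add: inv_into_f_f)
      then show "y \<in> \<phi> ` A" using x y unfolding A_def by force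
    qed
  qed
  have inj: "inj_on \<phi> A"
    by (rule inj_onI) (metis A_def AW IntD1 P(4) inj_onD phi2(2) subsetD)
  let ?f = "\<lambda>y. indicator U' y *\<^sub>R hnorm (horizontal_normal \<sigma>' y)"
  have f: "?f \<in> borel_measurable borel"
    using P'(1) by (intro borel_measurable_continuous_on_indicator continuous_hnorm_horizontal_normal[OF r']) auto
  have "emeasure (patch_measure \<sigma>' U') B = (\<integral>\<^sup>+y\<in>\<phi> ` A. ennreal (?f y) \<partial>lborel)"
    unfolding emeasure_patch_measure[OF r' B(1)] img by (intro nn_integral_cong) (auto simp: indicator_def)
  also have "\<dots> = (\<integral>\<^sup>+x\<in>A. ennreal (\<bar>det (matrix (frechet_derivative \<phi> (at x)))\<bar> * ?f (\<phi> x)) \<partial>lborel)"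
    by (rule nn_integral_change_of_variables[OF Ab _ phi' inj f])
       (use AW img meas[OF r'] in \<open>auto simp: indicator_def\<close>)
  also have "\<dots> = (\<integral>\<^sup>+x\<in>A. ennreal (hnorm (horizontal_normal \<sigma> x)) \<partial>lborel)"
  proof (rule nn_integral_cong)
    fix x :: "real^2"
    show "ennreal (\<bar>det (matrix (frechet_derivative \<phi> (at x)))\<bar> * ?f (\<phi> x)) * indicator A x
        = ennreal (hnorm (horizontal_normal \<sigma> x)) * indicator A x"
    proof (cases "x \<in> A")
      case True
      then have x: "x \<in> W" using AW by blast
      have "characteristic_direction \<sigma> x = det (matrix (frechet_derivative \<phi> (at x))) *\<^sub>R characteristic_direction \<sigma>' (\<phi> x)"
        by (rule characteristic_direction_reparametrize[OF C1_on_imp_has_derivative[OF P'(2)] phi'[OF x] W x])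
           (use phi2 x in auto)
      then show ?thesis using phi2(1)[OF x] by (simp add: hnorm_horizontal_normal hnorm_scaleR)
    qed simp
  qed
  also have "\<dots> = emeasure (patch_measure \<sigma> U) B"
    unfolding emeasure_patch_measure[OF r B(1)] A_def by (intro nn_integral_cong) (auto simp: indicator_def)
  finally show ?thesis ..
qed

section \<open>The horizontal area measure of a surface\<close>

definition covered_by_patches :: "heis set \<Rightarrow> bool" where
  "covered_by_patches S \<longleftrightarrow> (\<forall>p\<in>S. \<exists>\<sigma> U. patch_of S \<sigma> U \<and> p \<in> \<sigma> ` U)"

lemma patch_of_empty: "patch_of S \<sigma> {}"
  by (auto simp: patch_of_def regular_patch_def C2_on_def C1_on_def homeomorphism_def)

text \<open>
  Patches have relatively open images, so the Lindelof property yields a countable subcover; the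
  empty patch is adjoined so that an enumeration exists even if the surface is empty.
\<close>

lemma covered_by_patches_sequence:
  assumes "covered_by_patches S"
  obtains \<sigma> :: "nat \<Rightarrow> real^2 \<Rightarrow> heis" and U :: "nat \<Rightarrow> (real^2) set"
  where "\<And>n. patch_of S (\<sigma> n) (U n)" "S = (\<Union>n. \<sigma> n ` U n)"
proof -
  define \<F> where "\<F> = {\<sigma> ` U | \<sigma> U. patch_of S \<sigma> U}"
  have "openin (top_of_set S) T" if "T \<in> \<F>" for T using that unfolding \<F>_def patch_of_def by blast
  from Lindelof_openin[OF this] obtain \<G> where G: "\<G> \<subseteq> \<F>" "countable \<G>" "\<Union>\<G> = \<Union>\<F>" by metis
  have "\<Union>\<F> \<subseteq> S"
    unfolding \<F>_def patch_of_def by (auto dest: openin_imp_subset)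
  moreover have "S \<subseteq> \<Union>\<F>"
  proof
    fix p assume "p \<in> S"
    then obtain \<sigma> U where "patch_of S \<sigma> U" "p \<in> \<sigma> ` U" using assms unfolding covered_by_patches_def by metis
    then show "p \<in> \<Union>\<F>" unfolding \<F>_def by (intro UnionI[of "\<sigma> ` U"]) auto
  qed
  moreover have "id ` {} \<in> \<F>" unfolding \<F>_def using patch_of_empty by (metis (mono_tags, lifting) image_empty mem_Collect_eq)
  ultimately have H: "insert {} \<G> \<subseteq> \<F>" "countable (insert {} \<G>)" "\<Union>(insert {} \<G>) = S" using G by auto
  define A where "A = from_nat_into (insert {} \<G>)"
  have A: "range A = insert {} \<G>" unfolding A_def using H(2) by (intro range_from_nat_into) auto
  have "\<exists>\<sigma> U. patch_of S \<sigma> U \<and> A n = \<sigma> ` U" for n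
  proof -
    have "A n \<in> \<F>" using H(1) rangeI[of A n] unfolding A by (rule subsetD)
    then show ?thesis unfolding \<F>_def by auto
  qed
  then obtain \<sigma> U where p: "\<And>n. patch_of S (\<sigma> n) (U n)" and AU: "\<And>n. A n = \<sigma> n ` U n" by metis
  have "S = (\<Union>n. \<sigma> n ` U n)" using A H(3) unfolding AU[symmetric] by simp
  with p show ?thesis by (rule that)
qed

lemma patch_image_borel: "patch_of S \<sigma> U \<Longrightarrow> \<sigma> ` U \<in> sets borel"
  unfolding patch_of_def by (auto intro: continuous_image_open_borel regular_patchD(1,3))

text \<open>
  The defining property of \<open>horizontal_area\<close>, with the integral over a patch expressed by
  \<open>patch_measure\<close>.
\<close>

definition horizontal_area_measure :: "heis set \<Rightarrow> heis measure \<Rightarrow> bool" where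
  "horizontal_area_measure S M \<longleftrightarrow> sets M = sets borel \<and> emeasure M (- S) = 0 \<and>
     (\<forall>\<sigma> U A. patch_of S \<sigma> U \<longrightarrow> A \<in> sets borel \<longrightarrow>
        emeasure M (A \<inter> \<sigma> ` U) = emeasure (patch_measure \<sigma> U) A)"

lemma horizontal_area_eq_The: "horizontal_area S = (THE M. horizontal_area_measure S M)"
  unfolding horizontal_area_def horizontal_area_measure_def
  by (intro arg_cong[of _ _ The] ext) (auto simp: patch_of_def emeasure_patch_measure)

lemma sets_disjointed:
  assumes "\<And>n. E n \<in> sets M"
  shows "disjointed E n \<in> sets M"
  using sets.range_disjointed_sets[of E M] assms by (simp add: image_subset_iff)

lemma emeasure_disjointed_sum:
  assumes "sets M = sets borel" "A \<in> sets borel" "\<And>n::nat. E n \<in> sets borel" "emeasure M (- (\<Union>n. E n)) = 0"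
  shows "emeasure M A = (\<Sum>n. emeasure M (A \<inter> disjointed E n))"
proof -
  have D: "disjointed E n \<in> sets borel" for n
    by (rule sets_disjointed) (rule assms(3))
  have "(\<Union>n. E n) \<in> sets borel" using assms(3) by (intro sets.countable_UN) blast
  then have "- (\<Union>n. E n) \<in> null_sets M"
    by (intro null_setsI assms(4)) (simp only: assms(1) borel_comp)
  moreover have A: "A \<in> sets M" using assms(1,2) by (simp only:)
  ultimately have "A \<inter> - (\<Union>n. E n) \<in> null_sets M"
    by (rule null_set_Int1)
  from emeasure_Diff_null_set[OF this A]
  have "emeasure M A = emeasure M (A - (A \<inter> - (\<Union>n. E n)))" ..
  also have "A - (A \<inter> - (\<Union>n. E n)) = (\<Union>n. A \<inter> disjointed E n)"
    using UN_disjointed_eq[of E] by blast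
  also have "emeasure M \<dots> = (\<Sum>n. emeasure M (A \<inter> disjointed E n))"
  proof (rule suminf_emeasure[symmetric])
    show "range (\<lambda>n. A \<inter> disjointed E n) \<subseteq> sets M"
      unfolding assms(1) using D assms(2) by auto
    show "disjoint_family (\<lambda>n. A \<inter> disjointed E n)"
      using disjoint_family_disjointed[of E] unfolding disjoint_family_on_def by blast
  qed
  finally show ?thesis .
qed

text \<open>
  Disjointifying a countable cover by patches cuts every Borel set, up to a part of the null set
  \<open>- S\<close>, into pieces inside single patches, where the measure is prescribed.
\<close>

lemma horizontal_area_measure_unique:
  assumes "covered_by_patches S" "horizontal_area_measure S M" "horizontal_area_measure S M'"
  shows "M = M'"
proof (rule measure_eqI)
  obtain \<sigma> :: "nat \<Rightarrow> real^2 \<Rightarrow> heis" and U where p: "\<And>n. patch_of S (\<sigma> n) (U n)" and S: "S = (\<Union>n. \<sigma> n ` U n)"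
    by (rule covered_by_patches_sequence[OF assms(1)]) (rule that)
  define E where "E n = \<sigma> n ` U n" for n
  have E: "E n \<in> sets borel" for n unfolding E_def by (rule patch_image_borel[OF p])
  have D: "disjointed E n \<in> sets borel" for n
    by (rule sets_disjointed) (rule E)
  show sets: "sets M = sets M'" using assms unfolding horizontal_area_measure_def by simp
  fix A assume "A \<in> sets M"
  then have A: "A \<in> sets borel" using assms unfolding horizontal_area_measure_def by simp
  have *: "emeasure N A = (\<Sum>n. emeasure (patch_measure (\<sigma> n) (U n)) (A \<inter> disjointed E n))"
    if N: "horizontal_area_measure S N" for N
  proof -
    have "emeasure N A = (\<Sum>n. emeasure N (A \<inter> disjointed E n))"
      using N S unfolding horizontal_area_measure_def by (intro emeasure_disjointed_sum A E) (auto simp: E_def)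
    also have "\<dots> = (\<Sum>n. emeasure (patch_measure (\<sigma> n) (U n)) (A \<inter> disjointed E n))"
    proof (intro suminf_cong)
      fix n
      have "A \<inter> disjointed E n = (A \<inter> disjointed E n) \<inter> \<sigma> n ` U n"
        using disjointed_subset[of E n] unfolding E_def by blast
      then show "emeasure N (A \<inter> disjointed E n) = emeasure (patch_measure (\<sigma> n) (U n)) (A \<inter> disjointed E n)"
        using N p[of n] A D[of n] unfolding horizontal_area_measure_def by (metis sets.Int)
    qed
    finally show ?thesis .
  qed
  show "emeasure M A = emeasure M' A" using *[OF assms(2)] *[OF assms(3)] by simp
qed

text \<open>
  The same decomposition defines the measure: on the piece \<open>disjointed E n\<close> it is the one of the \<open>n\<close>-th
  patch. Any other patch sees the right values because patch measures agree on overlaps.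
\<close>

lemma horizontal_area_measure_exists:
  assumes "covered_by_patches S"
  shows "\<exists>M. horizontal_area_measure S M"
proof -
  obtain \<sigma> :: "nat \<Rightarrow> real^2 \<Rightarrow> heis" and U where p: "\<And>n. patch_of S (\<sigma> n) (U n)" and S: "S = (\<Union>n. \<sigma> n ` U n)"
    by (rule covered_by_patches_sequence[OF assms(1)]) (rule that)
  define E where "E n = \<sigma> n ` U n" for n
  have E: "E n \<in> sets borel" for n unfolding E_def by (rule patch_image_borel[OF p])
  have D: "disjointed E n \<in> sets borel" for n
    by (rule sets_disjointed) (rule E)
  define m where "m n = patch_measure (\<sigma> n) (U n)" for n
  define \<mu> where "\<mu> A = (\<Sum>n. emeasure (m n) (A \<inter> disjointed E n))" for A
  define M where "M = measure_of UNIV (sets borel) \<mu>"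
  have M: "sets M = sets borel" unfolding M_def by (simp add: sets.sigma_sets_eq[of borel, simplified])
  have em: "emeasure M A = \<mu> A" if "A \<in> sets borel" for A
    unfolding M_def
  proof (rule emeasure_measure_of_sigma[OF _ _ _ that])
    show "sigma_algebra UNIV (sets (borel :: heis measure))"
      using sets.sigma_algebra_axioms[of "borel :: heis measure"] by simp
    show "positive (sets borel) \<mu>" by (simp add: positive_def \<mu>_def)
    show "countably_additive (sets borel) \<mu>"
    proof (rule countably_additiveI)
      fix A :: "nat \<Rightarrow> heis set"
      assume A: "range A \<subseteq> sets borel" "disjoint_family A"
      have "emeasure (m n) (\<Union> (range A) \<inter> disjointed E n) = (\<Sum>i. emeasure (m n) (A i \<inter> disjointed E n))" for n
      proof -
        have "\<Union> (range A) \<inter> disjointed E n = (\<Union>i. A i \<inter> disjointed E n)" by blast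
        moreover have "range (\<lambda>i. A i \<inter> disjointed E n) \<subseteq> sets (m n)"
          using A(1) D[of n] by (auto simp: m_def)
        moreover have "disjoint_family (\<lambda>i. A i \<inter> disjointed E n)"
          using A(2) unfolding disjoint_family_on_def by blast
        ultimately show ?thesis by (simp only: suminf_emeasure)
      qed
      then have "\<mu> (\<Union> (range A)) = (\<integral>\<^sup>+n. (\<Sum>i. emeasure (m n) (A i \<inter> disjointed E n)) \<partial>count_space UNIV)"
        by (simp add: \<mu>_def nn_integral_count_space_nat)
      also have "\<dots> = (\<Sum>i. \<mu> (A i))"
        by (subst nn_integral_suminf) (auto simp: nn_integral_count_space_nat \<mu>_def)
      finally show "(\<Sum>i. \<mu> (A i)) = \<mu> (\<Union> (range A))" by simp
    qed
  qed
  have "horizontal_area_measure S M"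
    unfolding horizontal_area_measure_def
  proof (intro conjI allI impI M)
    have "- S \<in> sets borel" using E unfolding S E_def by auto
    moreover have "- S \<inter> disjointed E n = {}" for n
      using disjointed_subset[of E n] unfolding S E_def by blast
    ultimately show "emeasure M (- S) = 0" by (simp add: em \<mu>_def)
    fix s V and A :: "heis set" assume s: "patch_of S s V" and A: "A \<in> sets borel"
    note Vb = patch_image_borel[OF s]
    have "emeasure M (A \<inter> s ` V) = (\<Sum>n. emeasure (m n) (A \<inter> s ` V \<inter> disjointed E n))"
      using A Vb by (simp add: em \<mu>_def)
    also have "\<dots> = (\<Sum>n. emeasure (patch_measure s V) (A \<inter> s ` V \<inter> disjointed E n))"
    proof (intro suminf_cong)
      fix n
      show "emeasure (m n) (A \<inter> s ` V \<inter> disjointed E n) = emeasure (patch_measure s V) (A \<inter> s ` V \<inter> disjointed E n)"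
        unfolding m_def
        by (rule patch_measure_transition[OF p s]) (use A Vb D[of n] disjointed_subset[of E n] in \<open>auto simp: E_def\<close>)
    qed
    also have "\<dots> = emeasure (patch_measure s V) (A \<inter> s ` V)"
    proof (rule emeasure_disjointed_sum[symmetric])
      have rs: "regular_patch s V" using s by (simp add: patch_of_def)
      have sub: "s ` V \<subseteq> (\<Union>n. E n)"
        using s unfolding E_def S[symmetric] patch_of_def by (blast dest: openin_imp_subset)
      have "- (\<Union>n. E n) \<in> sets borel" using E by (intro borel_comp sets.countable_UN) blast
      note emeasure_patch_measure[OF rs this]
      also have "(\<integral>\<^sup>+w\<in>V. indicator (- (\<Union>n. E n)) (s w) * ennreal (hnorm (horizontal_normal s w)) \<partial>lborel)
          = (\<integral>\<^sup>+w. 0 \<partial>(lborel :: (real^2) measure))"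
        by (rule nn_integral_cong) (use sub in \<open>auto simp: indicator_def image_subset_iff\<close>)
      finally show "emeasure (patch_measure s V) (- (\<Union>n. E n)) = 0" by simp
    qed (use A Vb E in auto)
    also have "\<dots> = emeasure (patch_measure s V) A"
      using s A Vb by (subst (1 2) emeasure_patch_measure)
        (auto simp: patch_of_def indicator_def intro!: nn_integral_cong)
    finally show "emeasure M (A \<inter> s ` V) = emeasure (patch_measure s V) A" .
  qed
  then show ?thesis ..
qed

lemma horizontal_area_measure_horizontal_area:
  assumes "covered_by_patches S"
  shows "horizontal_area_measure S (horizontal_area S)"
  unfolding horizontal_area_eq_The
  using horizontal_area_measure_exists[OF assms] horizontal_area_measure_unique[OF assms]
  by (metis theI)

lemma nn_integral_horizontal_area_patch:
  assumes S: "covered_by_patches S" and p: "patch_of S \<sigma> U"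
    and D: "D \<in> sets borel" "D \<subseteq> \<sigma> ` U" and F: "F \<in> borel_measurable borel"
  shows "(\<integral>\<^sup>+p\<in>D. F p \<partial>horizontal_area S) =
    (\<integral>\<^sup>+w\<in>U. F (\<sigma> w) * indicator D (\<sigma> w) * ennreal (hnorm (horizontal_normal \<sigma> w)) \<partial>lborel)"
proof -
  let ?M = "horizontal_area S" and ?m = "patch_measure \<sigma> U"
  have M: "horizontal_area_measure S ?M" by (rule horizontal_area_measure_horizontal_area[OF S])
  then have sM [simp, measurable_cong]: "sets ?M = sets borel" unfolding horizontal_area_measure_def by blast
  note [measurable] = D(1) F
  have "density ?M (indicator D) = density ?m (indicator D)"
  proof (rule measure_eqI)
    fix A assume "A \<in> sets (density ?M (indicator D))"
    then have A [measurable]: "A \<in> sets borel" by simp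
    have "emeasure ?M (D \<inter> A) = emeasure ?M ((D \<inter> A) \<inter> \<sigma> ` U)"
      using D(2) by (intro arg_cong[of _ _ "emeasure ?M"]) blast
    also have "\<dots> = emeasure ?m (D \<inter> A)"
      using M p D(1) A unfolding horizontal_area_measure_def by (metis sets.Int)
    finally show "emeasure (density ?M (indicator D)) A = emeasure (density ?m (indicator D)) A"
      using D(1) A by (simp add: emeasure_density flip: indicator_inter_arith)
  qed simp
  then have "(\<integral>\<^sup>+p. F p \<partial>density ?M (indicator D)) = (\<integral>\<^sup>+p. F p \<partial>density ?m (indicator D))" by simp
  then have "(\<integral>\<^sup>+p\<in>D. F p \<partial>?M) = (\<integral>\<^sup>+p. F p * indicator D p \<partial>?m)"
    by (simp add: nn_integral_density mult.commute)
  also have "\<dots> = (\<integral>\<^sup>+w\<in>U. F (\<sigma> w) * indicator D (\<sigma> w) * ennreal (hnorm (horizontal_normal \<sigma> w)) \<partial>lborel)"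
    using p unfolding patch_of_def by (subst nn_integral_patch_measure) auto
  finally show ?thesis .
qed

text \<open>
  An integral over a surface becomes a sum of parameter integrals, taken over disjoint pieces. For
  two surfaces related by a map, the pieces correspond, and integrals can be compared term by term.
\<close>

lemma nn_integral_horizontal_area_sum:
  fixes \<sigma> :: "nat \<Rightarrow> real^2 \<Rightarrow> heis"
  assumes p: "\<And>n. patch_of S (\<sigma> n) (U n)" and S: "S = (\<Union>n. \<sigma> n ` U n)"
    and F: "F \<in> borel_measurable borel"
  shows "(\<integral>\<^sup>+p. F p \<partial>horizontal_area S) =
    (\<Sum>n. \<integral>\<^sup>+w\<in>U n. F (\<sigma> n w) * indicator (disjointed (\<lambda>n. \<sigma> n ` U n) n) (\<sigma> n w)
       * ennreal (hnorm (horizontal_normal (\<sigma> n) w)) \<partial>lborel)"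
proof -
  let ?E = "\<lambda>n. \<sigma> n ` U n"
  have cov: "covered_by_patches S" using p S unfolding covered_by_patches_def by blast
  let ?M = "horizontal_area S"
  have M: "horizontal_area_measure S ?M" by (rule horizontal_area_measure_horizontal_area[OF cov])
  then have sM [simp, measurable_cong]: "sets ?M = sets borel" unfolding horizontal_area_measure_def by blast
  have E: "?E n \<in> sets borel" for n by (rule patch_image_borel[OF p])
  have D: "disjointed ?E n \<in> sets borel" for n
    by (rule sets_disjointed) (rule E)
  note [measurable] = F D
  have "- S \<in> null_sets ?M"
    using M E unfolding null_sets_def horizontal_area_measure_def S by auto
  then have "AE p in ?M. p \<in> S" by (rule AE_I') auto
  then have "(\<integral>\<^sup>+p. F p \<partial>?M) = (\<integral>\<^sup>+p. (\<Sum>n. F p * indicator (disjointed ?E n) p) \<partial>?M)"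
  proof (intro nn_integral_cong_AE, eventually_elim)
    fix p assume "p \<in> S"
    then have "(\<Sum>n. indicator (disjointed ?E n) p) = (1 :: ennreal)"
      using suminf_indicator[OF disjoint_family_disjointed[of ?E], of p] UN_disjointed_eq[of ?E] S
      by (simp add: indicator_def)
    then show "F p = (\<Sum>n. F p * indicator (disjointed ?E n) p)"
      by (simp add: ennreal_suminf_cmult)
  qed
  also have "\<dots> = (\<Sum>n. \<integral>\<^sup>+p\<in>disjointed ?E n. F p \<partial>?M)"
    by (intro nn_integral_suminf) measurable
  also have "\<dots> = (\<Sum>n. \<integral>\<^sup>+w\<in>U n. F (\<sigma> n w) * indicator (disjointed ?E n) (\<sigma> n w)
       * ennreal (hnorm (horizontal_normal (\<sigma> n) w)) \<partial>lborel)"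
    by (intro suminf_cong nn_integral_horizontal_area_patch cov p D F) (rule disjointed_subset)
  finally show ?thesis .
qed

lemma nn_integral_horizontal_area_single_patch:
  assumes p: "patch_of (\<sigma> ` U) \<sigma> U" and F: "F \<in> borel_measurable borel"
  shows "(\<integral>\<^sup>+p. F p \<partial>horizontal_area (\<sigma> ` U)) =
    (\<integral>\<^sup>+w\<in>U. F (\<sigma> w) * ennreal (hnorm (horizontal_normal \<sigma> w)) \<partial>lborel)"
proof -
  let ?S = "\<sigma> ` U"
  have cov: "covered_by_patches ?S" using p unfolding covered_by_patches_def by blast
  have M: "horizontal_area_measure ?S (horizontal_area ?S)" by (rule horizontal_area_measure_horizontal_area[OF cov])
  have S: "?S \<in> sets borel" by (rule patch_image_borel[OF p])
  have "- ?S \<in> null_sets (horizontal_area ?S)"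
    using M S unfolding null_sets_def horizontal_area_measure_def by auto
  then have "AE p in horizontal_area ?S. p \<in> ?S" by (rule AE_I') auto
  then have "(\<integral>\<^sup>+p. F p \<partial>horizontal_area ?S) = (\<integral>\<^sup>+p\<in>?S. F p \<partial>horizontal_area ?S)"
    by (intro nn_integral_cong_AE, eventually_elim) simp
  also have "\<dots> = (\<integral>\<^sup>+w\<in>U. F (\<sigma> w) * ennreal (hnorm (horizontal_normal \<sigma> w)) \<partial>lborel)"
    unfolding nn_integral_horizontal_area_patch[OF cov p S subset_refl F]
    by (intro nn_integral_cong) (auto simp: indicator_def)
  finally show ?thesis .
qed

section \<open>Upper bound for the modulus of an image family\<close>

lemma inj_frechet_derivative_contact:
  assumes "C2_contact_qc f \<Omega> \<Omega>'" "p \<in> \<Omega>"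
  shows "inj (frechet_derivative f (at p))"
proof -
  have "linear (frechet_derivative f (at p))"
    using C1_on_imp_has_derivative[OF C2_contact_qcD(5)[OF assms(1)] assms(2)] has_derivative_linear by blast
  moreover have "det (matrix (frechet_derivative f (at p))) \<noteq> 0"
    using det_frechet_derivative_contact[OF assms] C2_contact_qcD(9)[OF assms] by simp
  ultimately show ?thesis using det_nz_iff_inj by blast
qed

lemma homeomorphism_contact:
  assumes f: "C2_contact_qc f \<Omega> \<Omega>'"
  shows "homeomorphism \<Omega> \<Omega>' f (inv_into \<Omega> f)"
proof -
  note d = C2_contact_qcD[OF f]
  show ?thesis
    using d(3) C1_on_imp_continuous_on[OF d(5)] C1_on_imp_continuous_on[OF d(6)]
    unfolding homeomorphism_def bij_betw_def by (auto simp: inv_into_into f_inv_into_f)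
qed

lemma frechet_derivative_compose_patch:
  assumes f: "C2_contact_qc f \<Omega> \<Omega>'" and r: "regular_patch \<sigma> U" and w: "w \<in> U" and sub: "\<sigma> ` U \<subseteq> \<Omega>"
  shows "frechet_derivative (f \<circ> \<sigma>) (at w) = frechet_derivative f (at (\<sigma> w)) \<circ> frechet_derivative \<sigma> (at w)"
proof -
  have "\<sigma> w \<in> \<Omega>" using w sub by blast
  then have "(f \<circ> \<sigma> has_derivative frechet_derivative f (at (\<sigma> w)) \<circ> frechet_derivative \<sigma> (at w)) (at w)"
    by (intro diff_chain_at C1_on_imp_has_derivative[OF regular_patchD(2)[OF r] w]
        C1_on_imp_has_derivative[OF C2_contact_qcD(5)[OF f]])
  then show ?thesis by (rule frechet_derivative_at[symmetric])
qed

lemma patch_of_image: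
  assumes f: "C2_contact_qc f \<Omega> \<Omega>'" and S: "S \<subseteq> \<Omega>" and p: "patch_of S \<sigma> U"
  shows "patch_of (f ` S) (f \<circ> \<sigma>) U"
proof -
  have r: "regular_patch \<sigma> U" and op: "openin (top_of_set S) (\<sigma> ` U)" using p by (auto simp: patch_of_def)
  have sub: "\<sigma> ` U \<subseteq> \<Omega>" using op S openin_imp_subset by blast
  note d = C2_contact_qcD[OF f]
  have hS: "homeomorphism T (f ` T) f (inv_into \<Omega> f)" if "T \<subseteq> \<Omega>" for T
    by (rule homeomorphism_of_subsets[OF homeomorphism_contact[OF f] that])
       (use that homeomorphism_contact[OF f] in \<open>auto simp: homeomorphism_def\<close>)
  have "C2_on (f \<circ> \<sigma>) U"
    using C2_on_compose[OF _ d(4) sub] r unfolding regular_patch_def o_def by blast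
  moreover have "inj (frechet_derivative (f \<circ> \<sigma>) (at w))" if "w \<in> U" for w
    unfolding frechet_derivative_compose_patch[OF f r that sub]
    using that sub by (intro inj_compose inj_frechet_derivative_contact[OF f] regular_patchD(5)[OF r]) auto
  moreover have "homeomorphism U ((f \<circ> \<sigma>) ` U) (f \<circ> \<sigma>) (inv_into U \<sigma> \<circ> inv_into \<Omega> f)"
    unfolding image_comp[symmetric]
    by (rule homeomorphism_compose[OF regular_patchD(6)[OF r] hS[OF sub]])
  moreover have "openin (top_of_set (f ` S)) ((f \<circ> \<sigma>) ` U)"
    unfolding image_comp[symmetric] using homeomorphism_imp_open_map[OF hS[OF S] op] .
  ultimately show ?thesis
    unfolding patch_of_def regular_patch_def using regular_patchD(1)[OF r] by blast
qed

lemma characteristic_direction_image: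
  assumes f: "C2_contact_qc f \<Omega> \<Omega>'" and r: "regular_patch \<sigma> U" and w: "w \<in> U" and sub: "\<sigma> ` U \<subseteq> \<Omega>"
  shows "characteristic_direction (f \<circ> \<sigma>) w
    = contact_factor f (\<sigma> w) *\<^sub>R frechet_derivative f (at (\<sigma> w)) (characteristic_direction \<sigma> w)"
proof -
  have p: "\<sigma> w \<in> \<Omega>" using w sub by blast
  interpret D: linear "frechet_derivative f (at (\<sigma> w))"
    using C1_on_imp_has_derivative[OF C2_contact_qcD(5)[OF f] p] has_derivative_linear by blast
  have "contact_form (f (\<sigma> w)) (frechet_derivative f (at (\<sigma> w)) v)
      = contact_factor f (\<sigma> w) * contact_form (\<sigma> w) v" for v
    using C2_contact_qcD(8)[OF f p] unfolding pullback_factor_def by blast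
  then show ?thesis
    unfolding characteristic_direction_def Let_def frechet_derivative_compose_patch[OF f r w sub]
    by (simp add: D.diff D.scale scaleR_diff_right)
qed

lemma hnorm_horizontal_normal_image_ge:
  assumes f: "C2_contact_qc f \<Omega> \<Omega>'" and r: "regular_patch \<sigma> U" and w: "w \<in> U" and sub: "\<sigma> ` U \<subseteq> \<Omega>"
  shows "area_stretch f (\<sigma> w) * hnorm (horizontal_normal \<sigma> w) \<le> hnorm (horizontal_normal (f \<circ> \<sigma>) w)"
proof -
  have p: "\<sigma> w \<in> \<Omega>" using w sub by blast
  have l: "0 < contact_factor f (\<sigma> w)" by (rule C2_contact_qcD(9)[OF f p])
  from mult_left_mono[OF hnorm_frechet_derivative_ge[OF f p contact_form_characteristic_direction[of \<sigma> w]] less_imp_le[OF l]]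
  show ?thesis
    unfolding hnorm_horizontal_normal characteristic_direction_image[OF f r w sub] hnorm_scaleR area_stretch_def
    using l by (simp add: mult.assoc)
qed

text \<open>
  At characteristic points, which the minimal stretching property excludes, both sides vanish: the
  characteristic direction is zero there and so is its image.
\<close>

lemma hnorm_horizontal_normal_image_eq:
  assumes f: "C2_contact_qc f \<Omega> \<Omega>'" and p: "patch_of S \<sigma> U" and w: "w \<in> U" and sub: "S \<subseteq> \<Omega>"
    and mSP: "minimal_stretching f S"
  shows "hnorm (horizontal_normal (f \<circ> \<sigma>) w) = area_stretch f (\<sigma> w) * hnorm (horizontal_normal \<sigma> w)"
proof (cases "horizontal_normal \<sigma> w = 0")
  case False
  then show ?thesis using mSP p w unfolding minimal_stretching_def area_stretch_def by blast
next
  case True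
  have r: "regular_patch \<sigma> U" and sub': "\<sigma> ` U \<subseteq> \<Omega>"
    using p sub unfolding patch_of_def by (auto dest: openin_imp_subset)
  then have q: "\<sigma> w \<in> \<Omega>" using w by blast
  have "hnorm (characteristic_direction \<sigma> w) = 0" using True hnorm_horizontal_normal hnorm_horizontal_normal_eq_0_iff by metis
  then have "characteristic_direction \<sigma> w = 0"
    using contact_form_characteristic_direction[of \<sigma> w]
    by (auto simp: hnorm_def contact_form_def vec_eq_iff forall_3 sum_power2_eq_zero_iff)
  moreover have "linear (frechet_derivative f (at (\<sigma> w)))"
    using C1_on_imp_has_derivative[OF C2_contact_qcD(5)[OF f] q] has_derivative_linear by blast
  ultimately have "hnorm (characteristic_direction (f \<circ> \<sigma>) w) = 0"
    unfolding characteristic_direction_image[OF f r w sub'] hnorm_scaleR by (simp add: linear_0 hnorm_def)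
  then show ?thesis using True hnorm_horizontal_normal_eq_0_iff by (metis hnorm_horizontal_normal mult_zero_right)
qed

text \<open>
  The density \<open>\<rho> / s\<close> transported to \<open>\<Omega>'\<close>. Dividing by the guaranteed stretching factor \<open>s\<close> is what keeps the
  integrals over surfaces from decreasing.
\<close>

definition push_density :: "(heis \<Rightarrow> heis) \<Rightarrow> heis set \<Rightarrow> heis set \<Rightarrow> (heis \<Rightarrow> real) \<Rightarrow> heis \<Rightarrow> real" where
  "push_density f \<Omega> \<Omega>' \<rho> q =
     (if q \<in> \<Omega>' then \<rho> (inv_into \<Omega> f q) / area_stretch f (inv_into \<Omega> f q) else 0)"

lemma push_density_image:
  assumes "C2_contact_qc f \<Omega> \<Omega>'" "p \<in> \<Omega>"
  shows "push_density f \<Omega> \<Omega>' \<rho> (f p) = \<rho> p / area_stretch f p"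
  using C2_contact_qcD(3)[OF assms(1)] assms(2) unfolding push_density_def bij_betw_def
  by (auto simp: inv_into_f_f)

lemma borel_measurable_extend_by_zero:
  fixes g :: "'a::topological_space \<Rightarrow> real"
  assumes "open S" "g \<in> borel_measurable (restrict_space borel S)"
  shows "(\<lambda>x. indicator S x *\<^sub>R g x) \<in> borel_measurable borel"
  using assms borel_measurable_restrict_space_iff[of S borel g] by simp

lemma push_density_measurable:
  assumes f: "C2_contact_qc f \<Omega> \<Omega>'" and r: "\<rho> \<in> borel_measurable borel"
  shows "push_density f \<Omega> \<Omega>' \<rho> \<in> borel_measurable borel"
proof -
  note d = C2_contact_qcD[OF f]
  have g: "continuous_on \<Omega>' (inv_into \<Omega> f)" by (rule C1_on_imp_continuous_on[OF d(6)])
  have s: "continuous_on \<Omega>' (\<lambda>q. area_stretch f (inv_into \<Omega> f q))"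
    by (rule continuous_on_compose2[OF continuous_on_area_stretch[OF f] g])
       (use homeomorphism_contact[OF f] in \<open>auto simp: homeomorphism_def\<close>)
  have "(\<lambda>q. \<rho> (inv_into \<Omega> f q) / area_stretch f (inv_into \<Omega> f q)) \<in> borel_measurable (restrict_space borel \<Omega>')"
    by (intro borel_measurable_divide measurable_compose[OF borel_measurable_continuous_on_restrict[OF g] r]
        borel_measurable_continuous_on_restrict s)
  from borel_measurable_extend_by_zero[OF d(2) this]
  show ?thesis by (rule measurable_cong[THEN iffD1, rotated]) (auto simp: push_density_def)
qed

text \<open>
  A cover of \<open>S\<close> by patches is carried by \<open>f\<close> to one of \<open>f ` S\<close>, and disjointification commutes with the
  injective map \<open>f\<close>. In each parameter domain the integrand grows, since horizontal area is stretched
  by at least \<open>area_stretch f\<close>.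
\<close>

lemma push_density_admissible:
  assumes f: "C2_contact_qc f \<Omega> \<Omega>'" and r: "\<rho> \<in> Adm \<Sigma>"
    and S: "\<And>S. S \<in> \<Sigma> \<Longrightarrow> covered_by_patches S \<and> S \<subseteq> \<Omega>"
  shows "push_density f \<Omega> \<Omega>' \<rho> \<in> Adm (image_family f \<Sigma>)"
proof -
  have rb: "\<rho> \<in> borel_measurable borel" and r0: "\<And>p. 0 \<le> \<rho> p"
    and r1: "\<And>S. S \<in> \<Sigma> \<Longrightarrow> 1 \<le> (\<integral>\<^sup>+p. ennreal (\<rho> p) \<partial>horizontal_area S)"
    using r unfolding Adm_def by auto
  let ?\<rho> = "push_density f \<Omega> \<Omega>' \<rho>"
  have m: "?\<rho> \<in> borel_measurable borel" by (rule push_density_measurable[OF f rb])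
  have nn: "0 \<le> ?\<rho> q" for q
    using r0 area_stretch_pos[OF f, of "inv_into \<Omega> f q"] homeomorphism_contact[OF f]
    unfolding push_density_def homeomorphism_def by (auto intro!: divide_nonneg_pos)
  have "1 \<le> (\<integral>\<^sup>+p. ennreal (?\<rho> p) \<partial>horizontal_area (f ` S))" if "S \<in> \<Sigma>" for S
  proof -
    have cov: "covered_by_patches S" and sub: "S \<subseteq> \<Omega>" using S[OF that] by auto
    obtain \<sigma> :: "nat \<Rightarrow> real^2 \<Rightarrow> heis" and U where p: "\<And>n. patch_of S (\<sigma> n) (U n)" and SU: "S = (\<Union>n. \<sigma> n ` U n)"
      by (rule covered_by_patches_sequence[OF cov]) (rule that)
    let ?E = "\<lambda>n. \<sigma> n ` U n" and ?E' = "\<lambda>n. (f \<circ> \<sigma> n) ` U n"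
    have p': "patch_of (f ` S) (f \<circ> \<sigma> n) (U n)" for n by (rule patch_of_image[OF f sub p])
    have SU': "f ` S = (\<Union>n. ?E' n)" unfolding SU by (simp add: image_UN image_comp)
    have inj: "inj_on f \<Omega>" using C2_contact_qcD(3)[OF f] by (simp add: bij_betw_def)
    have E\<Omega>: "?E n \<subseteq> \<Omega>" for n using sub unfolding SU by blast
    have dis: "f q \<in> disjointed ?E' n \<longleftrightarrow> q \<in> disjointed ?E n" if "q \<in> \<Omega>" for q n
    proof -
      have "f q \<in> ?E' k \<longleftrightarrow> q \<in> ?E k" for k
        using inj_on_image_mem_iff[OF inj that E\<Omega>[of k]] by (simp add: image_comp)
      then show ?thesis unfolding disjointed_def by simp
    qed
    have "1 \<le> (\<integral>\<^sup>+p. ennreal (\<rho> p) \<partial>horizontal_area S)" by (rule r1[OF that])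
    also have "\<dots> = (\<Sum>n. \<integral>\<^sup>+w\<in>U n. ennreal (\<rho> (\<sigma> n w)) * indicator (disjointed ?E n) (\<sigma> n w)
       * ennreal (hnorm (horizontal_normal (\<sigma> n) w)) \<partial>lborel)"
      using rb by (intro nn_integral_horizontal_area_sum p SU) simp
    also have "\<dots> \<le> (\<Sum>n. \<integral>\<^sup>+w\<in>U n. ennreal (?\<rho> ((f \<circ> \<sigma> n) w)) * indicator (disjointed ?E' n) ((f \<circ> \<sigma> n) w)
       * ennreal (hnorm (horizontal_normal (f \<circ> \<sigma> n) w)) \<partial>lborel)"
    proof (intro suminf_le nn_integral_mono summableI)
      fix n w
      show "ennreal (\<rho> (\<sigma> n w)) * indicator (disjointed ?E n) (\<sigma> n w)
         * ennreal (hnorm (horizontal_normal (\<sigma> n) w)) * indicator (U n) w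
        \<le> ennreal (?\<rho> ((f \<circ> \<sigma> n) w)) * indicator (disjointed ?E' n) ((f \<circ> \<sigma> n) w)
         * ennreal (hnorm (horizontal_normal (f \<circ> \<sigma> n) w)) * indicator (U n) w"
      proof (cases "w \<in> U n \<and> \<sigma> n w \<in> disjointed ?E n")
        case True
        then have w: "w \<in> U n" "\<sigma> n w \<in> \<Omega>" using E\<Omega>[of n] by auto
        have rp: "regular_patch (\<sigma> n) (U n)" using p by (simp add: patch_of_def)
        have "\<rho> (\<sigma> n w) * hnorm (horizontal_normal (\<sigma> n) w)
            = \<rho> (\<sigma> n w) / area_stretch f (\<sigma> n w) * (area_stretch f (\<sigma> n w) * hnorm (horizontal_normal (\<sigma> n) w))"
          using area_stretch_pos[OF f w(2)] by simp
        also have "\<dots> \<le> \<rho> (\<sigma> n w) / area_stretch f (\<sigma> n w) * hnorm (horizontal_normal (f \<circ> \<sigma> n) w)"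
          using area_stretch_pos[OF f w(2)] r0
          by (intro mult_left_mono hnorm_horizontal_normal_image_ge[OF f rp w(1) E\<Omega>]) auto
        finally have "\<rho> (\<sigma> n w) * hnorm (horizontal_normal (\<sigma> n) w)
            \<le> ?\<rho> ((f \<circ> \<sigma> n) w) * hnorm (horizontal_normal (f \<circ> \<sigma> n) w)"
          by (simp add: push_density_image[OF f w(2)])
        from ennreal_leI[OF this] show ?thesis
          using True dis[OF w(2)] r0 nn by (simp add: ennreal_mult)
      next
        case False
        then show ?thesis by (auto simp: indicator_def)
      qed
    qed
    also have "\<dots> = (\<integral>\<^sup>+p. ennreal (?\<rho> p) \<partial>horizontal_area (f ` S))"
      using m by (intro nn_integral_horizontal_area_sum[symmetric] p' SU') simp
    finally show ?thesis .
  qed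
  then show ?thesis unfolding Adm_def image_family_def using m nn by auto
qed

lemma nn_integral_contact_change_of_variables:
  assumes f: "C2_contact_qc f \<Omega> \<Omega>'" and g: "g \<in> borel_measurable borel" "\<And>q. 0 \<le> g q"
  shows "(\<integral>\<^sup>+q\<in>\<Omega>'. ennreal (g q) \<partial>lborel) = (\<integral>\<^sup>+p\<in>\<Omega>. ennreal ((contact_factor f p)\<^sup>2 * g (f p)) \<partial>lborel)"
proof -
  note d = C2_contact_qcD[OF f]
  have im: "f ` \<Omega> = \<Omega>'" and inj: "inj_on f \<Omega>" using d(3) by (auto simp: bij_betw_def)
  have "(\<integral>\<^sup>+q\<in>f ` \<Omega>. ennreal (g q) \<partial>lborel)
      = (\<integral>\<^sup>+p\<in>\<Omega>. ennreal (\<bar>det (matrix (frechet_derivative f (at p)))\<bar> * g (f p)) \<partial>lborel)"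
    by (rule nn_integral_change_of_variables[OF _ _ C1_on_imp_has_derivative[OF d(5)] inj g])
       (use d(1,2) im in auto)
  also have "\<dots> = (\<integral>\<^sup>+p\<in>\<Omega>. ennreal ((contact_factor f p)\<^sup>2 * g (f p)) \<partial>lborel)"
    by (intro nn_integral_cong) (auto simp: indicator_def det_frechet_derivative_contact[OF f])
  finally show ?thesis unfolding im .
qed

lemma Modulus_image_le:
  assumes f: "C2_contact_qc f \<Omega> \<Omega>'" and r: "\<rho> \<in> Adm \<Sigma>"
    and S: "\<And>S. S \<in> \<Sigma> \<Longrightarrow> covered_by_patches S \<and> S \<subseteq> \<Omega>"
  shows "Modulus (image_family f \<Sigma>) \<le> (\<integral>\<^sup>+p\<in>\<Omega>. ennreal (distortion f p powr (2/3) * \<rho> p powr (4/3)) \<partial>lborel)"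
proof -
  let ?\<rho> = "push_density f \<Omega> \<Omega>' \<rho>"
  have rb: "\<rho> \<in> borel_measurable borel" and r0: "\<And>p. 0 \<le> \<rho> p" using r unfolding Adm_def by auto
  have m: "?\<rho> \<in> borel_measurable borel" by (rule push_density_measurable[OF f rb])
  have "Modulus (image_family f \<Sigma>) \<le> (\<integral>\<^sup>+q. ennreal (?\<rho> q powr (4/3)) \<partial>lborel)"
    unfolding Modulus_def by (rule INF_lower[OF push_density_admissible[OF f r S]])
  also have "\<dots> = (\<integral>\<^sup>+q\<in>\<Omega>'. ennreal (?\<rho> q powr (4/3)) \<partial>lborel)"
    by (intro nn_integral_cong) (auto simp: push_density_def indicator_def)
  also have "\<dots> = (\<integral>\<^sup>+p\<in>\<Omega>. ennreal ((contact_factor f p)\<^sup>2 * ?\<rho> (f p) powr (4/3)) \<partial>lborel)"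
    using m by (intro nn_integral_contact_change_of_variables[OF f]) auto
  also have "\<dots> = (\<integral>\<^sup>+p\<in>\<Omega>. ennreal (distortion f p powr (2/3) * \<rho> p powr (4/3)) \<partial>lborel)"
  proof (intro nn_integral_cong)
    fix p
    have "(contact_factor f p)\<^sup>2 * ?\<rho> (f p) powr (4/3) = distortion f p powr (2/3) * \<rho> p powr (4/3)" if p: "p \<in> \<Omega>"
      unfolding push_density_image[OF f p] distortion_powr_area_stretch[OF f p, symmetric]
      using area_stretch_pos[OF f p] r0[of p] by (simp add: powr_divide)
    then show "ennreal ((contact_factor f p)\<^sup>2 * ?\<rho> (f p) powr (4/3)) * indicator \<Omega> p
        = ennreal (distortion f p powr (2/3) * \<rho> p powr (4/3)) * indicator \<Omega> p"
      by (auto simp: indicator_def)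
  qed
  finally show ?thesis .
qed

section \<open>Lower bound for the modulus of the images of the leaves\<close>

text \<open>
  Jensen's inequality in the form needed on a leaf: among functions of integral one over \<open>A\<close>, the constant
  one has the least \<open>p\<close>-th power integral. Young's inequality, with the second factor \<open>b\<close> chosen such that
  equality holds at the constant \<open>1 / measure M A\<close>, gives a pointwise tangent bound, which is
  integrated.
\<close>

lemma nn_integral_powr_ge:
  fixes \<phi> :: "'a \<Rightarrow> real"
  assumes A: "A \<in> sets M" "0 < emeasure M A" "emeasure M A < \<infinity>"
    and \<phi>: "\<phi> \<in> borel_measurable M" "\<And>x. 0 \<le> \<phi> x"
    and one: "1 \<le> (\<integral>\<^sup>+x\<in>A. ennreal (\<phi> x) \<partial>M)" and p: "1 < p"
  shows "ennreal (measure M A powr (1 - p)) \<le> (\<integral>\<^sup>+x\<in>A. ennreal (\<phi> x powr p) \<partial>M)"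
proof -
  define u where "u = measure M A"
  have eu: "emeasure M A = ennreal u"
    using A(3) unfolding u_def by (intro emeasure_eq_ennreal_measure) auto
  then have u: "0 < u" using A(2) by simp
  \<comment> \<open>\<open>b\<close> is \<open>c\<^bsup>p - 1\<^esup>\<close> for \<open>c = 1 / u\<close>, the slope of the tangent at \<open>c\<close> up to the factor \<open>p\<close>.\<close>
  define b where "b = u powr (1 - p)"
  have b: "0 < b" using u by (simp add: b_def)
  define q where "q = p / (p - 1)"
  have q: "1 < q" "1 / p + 1 / q = 1" using p by (auto simp: q_def field_simps)
  have bq: "b powr q = u powr (- p)"
  proof -
    have "(1 - p) * p / (p - 1) = - p" using p by (simp add: divide_simps) (simp add: algebra_simps)
    then show ?thesis by (simp add: b_def q_def powr_powr)
  qed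
  have pq: "p / q = p - 1" using p by (simp add: q_def)
  have young: "p * b * x \<le> x powr p + (p - 1) * u powr (- p)" if "0 \<le> x" for x
  proof -
    have "x * b \<le> x powr p / p + b powr q / q"
      by (rule Youngs_inequality) (use p q that b in auto)
    then have "p * (x * b) \<le> p * (x powr p / p + b powr q / q)" using p by (intro mult_left_mono) auto
    also have "\<dots> = x powr p + p / q * u powr (- p)" using p by (simp add: distrib_left bq)
    finally show ?thesis unfolding pq by (simp add: mult_ac)
  qed
  have uu: "u powr (- p) * u = b" using u unfolding b_def
    by (metis add.commute diff_conv_add_uminus less_imp_le powr_add powr_one)
  have "ennreal (p * b) \<le> ennreal (p * b) * (\<integral>\<^sup>+x\<in>A. ennreal (\<phi> x) \<partial>M)"
    using mult_left_mono[OF one, of "ennreal (p * b)"] by simp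
  also have "\<dots> = (\<integral>\<^sup>+x\<in>A. ennreal (p * b * \<phi> x) \<partial>M)"
    using \<phi> A(1) p b by (subst nn_integral_cmult[symmetric]) (auto simp: ennreal_mult mult_ac)
  also have "\<dots> \<le> (\<integral>\<^sup>+x. ennreal (\<phi> x powr p) * indicator A x + ennreal ((p - 1) * u powr (- p)) * indicator A x \<partial>M)"
  proof (intro nn_integral_mono)
    fix x
    have "ennreal (p * b * \<phi> x) \<le> ennreal (\<phi> x powr p) + ennreal ((p - 1) * u powr (- p))"
      using ennreal_leI[OF young[OF \<phi>(2)[of x]]] p by simp
    then show "ennreal (p * b * \<phi> x) * indicator A x
       \<le> ennreal (\<phi> x powr p) * indicator A x + ennreal ((p - 1) * u powr (- p)) * indicator A x"
      by (auto simp: indicator_def)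
  qed
  also have "\<dots> = (\<integral>\<^sup>+x\<in>A. ennreal (\<phi> x powr p) \<partial>M) + ennreal ((p - 1) * u powr (- p)) * emeasure M A"
    using \<phi> A(1) by (subst nn_integral_add) (auto simp: nn_integral_cmult_indicator)
  also have "ennreal ((p - 1) * u powr (- p)) * emeasure M A = ennreal ((p - 1) * b)"
    unfolding eu using p u uu by (simp add: ennreal_mult[symmetric] mult.assoc)
  finally have "ennreal b + ennreal ((p - 1) * b) \<le> (\<integral>\<^sup>+x\<in>A. ennreal (\<phi> x powr p) \<partial>M) + ennreal ((p - 1) * b)"
    using p b by (simp add: ennreal_plus[symmetric] algebra_simps del: ennreal_plus)
  then have "ennreal b \<le> (\<integral>\<^sup>+x\<in>A. ennreal (\<phi> x powr p) \<partial>M)"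
    by (simp add: ennreal_add_left_cancel_le add.commute)
  then show ?thesis by (simp add: b_def u_def)
qed

lemma rho0_leaf:
  assumes "inj_on \<Phi> (U \<times> J)" "w \<in> U" "\<tau> \<in> J"
  shows "rho0 \<Phi> U J (leaf \<Phi> \<tau> w) = (if horizontal_normal (leaf \<Phi> \<tau>) w = 0 then 0
    else 1 / (measure lborel U * hnorm (horizontal_normal (leaf \<Phi> \<tau>) w)))"
proof -
  have "inv_into (U \<times> J) \<Phi> (\<Phi> (w, \<tau>)) = (w, \<tau>)"
    using assms by (intro inv_into_f_f) auto
  then show ?thesis using assms unfolding rho0_def leaf_def by auto
qed

text \<open>
  For a competitor \<open>\<rho>\<close>, both the energy of \<open>\<rho>\<close> (pulled back to \<open>\<Omega>\<close>, with integrand \<open>g\<close>) and the distortion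
  integral (integrand \<open>h\<close>) are disintegrated over the leaves, and the comparison is made leaf by leaf.
  On a leaf \<open>h \<parallel>N\<^sup>h\<parallel>\<^bsup>4/3\<^esup>\<close> is the constant \<open>k\<^bsup>2/3\<^esup> \<bar>U\<bar>\<^bsup>-4/3\<^esup>\<close> off the characteristic points, whereas
  \<open>g \<parallel>N\<^sup>h\<parallel>\<^bsup>4/3\<^esup> = k\<^bsup>2/3\<^esup> \<phi>\<^bsup>4/3\<^esup>\<close> with \<open>\<phi>\<close> of integral at least one over \<open>U\<close>.
\<close>

lemma Modulus_image_leaves_ge:
  assumes U: "open U" "0 < emeasure lborel U" "emeasure lborel U < \<infinity>"
    and \<Phi>: "diffeo_on \<Phi> (U \<times> J) \<Omega>"
    and reg: "\<And>\<tau>. \<tau> \<in> J \<Longrightarrow> regular_patch (leaf \<Phi> \<tau>) U"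
    and \<mu>: "volume_disintegration \<Phi> U J \<Omega> \<mu>"
    and f: "C2_contact_qc f \<Omega> \<Omega>'"
    and mSP: "\<And>S. S \<in> leaves \<Phi> U J \<Longrightarrow> minimal_stretching f S"
    and k: "\<And>\<tau> w. \<tau> \<in> J \<Longrightarrow> w \<in> U \<Longrightarrow> distortion f (leaf \<Phi> \<tau> w) = k \<tau>"
    and rho0: "rho0 \<Phi> U J \<in> borel_measurable borel" "\<And>p. 0 \<le> rho0 \<Phi> U J p"
  shows "(\<integral>\<^sup>+p\<in>\<Omega>. ennreal (distortion f p powr (2/3) * rho0 \<Phi> U J p powr (4/3)) \<partial>lborel)
    \<le> Modulus (image_family f (leaves \<Phi> U J))"
  unfolding Modulus_def
proof (rule INF_greatest)
  fix \<rho> assume "\<rho> \<in> Adm (image_family f (leaves \<Phi> U J))"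
  then have rb: "\<rho> \<in> borel_measurable borel" and r0: "\<And>p. 0 \<le> \<rho> p"
    and r1: "\<And>\<tau>. \<tau> \<in> J \<Longrightarrow> 1 \<le> (\<integral>\<^sup>+p. ennreal (\<rho> p) \<partial>horizontal_area (f ` leaf \<Phi> \<tau> ` U))"
    unfolding Adm_def image_family_def leaves_def by auto
  note d = C2_contact_qcD[OF f]
  define u where "u = measure lborel U"
  have eu: "emeasure lborel U = ennreal u"
    using U(3) unfolding u_def by (intro emeasure_eq_ennreal_measure) auto
  then have u: "0 < u" using U(2) by simp
  have inj: "inj_on \<Phi> (U \<times> J)" and im: "\<Phi> ` (U \<times> J) = \<Omega>"
    using \<Phi> unfolding diffeo_on_def bij_betw_def by auto
  have in\<Omega>: "leaf \<Phi> \<tau> w \<in> \<Omega>" if "\<tau> \<in> J" "w \<in> U" for \<tau> w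
    using that im unfolding leaf_def by blast
  define g where "g p = (contact_factor f p)\<^sup>2 * \<rho> (f p) powr (4/3)" for p
  define h where "h p = distortion f p powr (2/3) * rho0 \<Phi> U J p powr (4/3)" for p
  let ?N = "\<lambda>\<tau> w. hnorm (horizontal_normal (leaf \<Phi> \<tau>) w)"
  have contf: "continuous_on \<Omega> f" by (rule C1_on_imp_continuous_on[OF d(5)])
  have gm: "g \<in> borel_measurable (restrict_space borel \<Omega>)"
    unfolding g_def[abs_def]
    by (intro borel_measurable_times borel_measurable_power powr_real_measurable
        measurable_compose[OF borel_measurable_continuous_on_restrict[OF contf] rb]
        borel_measurable_continuous_on_restrict continuous_on_Z_op(1)[OF f]) simp
  have hm: "h \<in> borel_measurable (restrict_space borel \<Omega>)"
    unfolding h_def[abs_def]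
    by (intro borel_measurable_times powr_real_measurable measurable_restrict_space1 rho0
        borel_measurable_continuous_on_restrict continuous_on_distortion[OF f]) simp_all
  have dis: "(\<integral>\<^sup>+p\<in>\<Omega>. ennreal (F p) \<partial>lborel)
      = (\<integral>\<^sup>+\<tau>. (\<integral>\<^sup>+w\<in>U. ennreal (F (\<Phi> (w, \<tau>)) * ?N \<tau> w powr (4/3)) \<partial>lborel) \<partial>\<mu>)"
    if "F \<in> borel_measurable (restrict_space borel \<Omega>)" "\<And>p. p \<in> \<Omega> \<Longrightarrow> 0 \<le> F p" for F
    using \<mu> that unfolding volume_disintegration_def by simp
  have J: "space \<mu> = J"
    using \<mu> sets_eq_imp_space_eq[of \<mu> "restrict_space borel J"]
    unfolding volume_disintegration_def by (simp add: space_restrict_space)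
  have "(\<integral>\<^sup>+p\<in>\<Omega>. ennreal (h p) \<partial>lborel)
      = (\<integral>\<^sup>+\<tau>. (\<integral>\<^sup>+w\<in>U. ennreal (h (\<Phi> (w, \<tau>)) * ?N \<tau> w powr (4/3)) \<partial>lborel) \<partial>\<mu>)"
    by (rule dis[OF hm]) (simp add: h_def)
  also have "\<dots> \<le> (\<integral>\<^sup>+\<tau>. (\<integral>\<^sup>+w\<in>U. ennreal (g (\<Phi> (w, \<tau>)) * ?N \<tau> w powr (4/3)) \<partial>lborel) \<partial>\<mu>)"
  proof (rule nn_integral_mono)
    fix \<tau> assume "\<tau> \<in> space \<mu>"
    then have \<tau>: "\<tau> \<in> J" by (simp add: J)
    let ?s = "leaf \<Phi> \<tau>"
    have p: "patch_of (?s ` U) ?s U" using reg[OF \<tau>] by (simp add: patch_of_def)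
    have sub: "?s ` U \<subseteq> \<Omega>" using in\<Omega>[OF \<tau>] by blast
    have p': "patch_of ((f \<circ> ?s) ` U) (f \<circ> ?s) U"
      using patch_of_image[OF f sub p] by (simp add: image_comp)
    have r': "regular_patch (f \<circ> ?s) U" using p' by (simp add: patch_of_def)
    have leaf: "?s ` U \<in> leaves \<Phi> U J" using \<tau> unfolding leaves_def by blast
    note N' = hnorm_horizontal_normal_image_eq[OF f p _ sub mSP[OF leaf]]
    define \<phi> where "\<phi> w = indicator U w *\<^sub>R (\<rho> (f (?s w)) * hnorm (horizontal_normal (f \<circ> ?s) w))" for w
    have \<phi>m: "\<phi> \<in> borel_measurable lborel"
    proof -
      have "(\<lambda>w. \<rho> ((f \<circ> ?s) w) * hnorm (horizontal_normal (f \<circ> ?s) w)) \<in> borel_measurable (restrict_space borel U)"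
        by (intro borel_measurable_times measurable_compose[OF borel_measurable_continuous_on_restrict[OF regular_patchD(3)[OF r']] rb]
          borel_measurable_continuous_on_restrict continuous_hnorm_horizontal_normal[OF r'])
      from borel_measurable_extend_by_zero[OF U(1) this] show ?thesis by (simp add: \<phi>_def[abs_def])
    qed
    have \<phi>0: "0 \<le> \<phi> w" for w using r0 by (simp add: \<phi>_def)
    have "1 \<le> (\<integral>\<^sup>+w\<in>U. ennreal (\<rho> ((f \<circ> ?s) w)) * ennreal (hnorm (horizontal_normal (f \<circ> ?s) w)) \<partial>lborel)"
      using r1[OF \<tau>] rb unfolding image_comp by (subst (asm) nn_integral_horizontal_area_single_patch[OF p']) auto
    also have "\<dots> = (\<integral>\<^sup>+w\<in>U. ennreal (\<phi> w) \<partial>lborel)"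
      using r0 by (intro nn_integral_cong) (auto simp: \<phi>_def indicator_def ennreal_mult)
    finally have "1 \<le> (\<integral>\<^sup>+w\<in>U. ennreal (\<phi> w) \<partial>lborel)" .
    from nn_integral_powr_ge[OF _ U(2,3) \<phi>m \<phi>0 this, of "4/3"]
    have H: "ennreal (u powr (- 1/3)) \<le> (\<integral>\<^sup>+w\<in>U. ennreal (\<phi> w powr (4/3)) \<partial>lborel)"
      using U(1) by (simp add: u_def)
    have "(\<integral>\<^sup>+w\<in>U. ennreal (h (\<Phi> (w, \<tau>)) * ?N \<tau> w powr (4/3)) \<partial>lborel)
        \<le> (\<integral>\<^sup>+w\<in>U. ennreal (k \<tau> powr (2/3) * u powr (- 4/3)) \<partial>lborel)"
    proof (rule nn_integral_mono)
      fix w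
      have "h (\<Phi> (w, \<tau>)) * ?N \<tau> w powr (4/3) \<le> k \<tau> powr (2/3) * u powr (- 4/3)" if w: "w \<in> U"
      proof -
        have hw: "h (\<Phi> (w, \<tau>)) = k \<tau> powr (2/3) * rho0 \<Phi> U J (?s w) powr (4/3)"
          using k[OF \<tau> w] by (simp add: h_def leaf_def)
        show ?thesis
        proof (cases "horizontal_normal ?s w = 0")
          case True
          then show ?thesis using hw rho0_leaf[OF inj w \<tau>] by simp
        next
          case False
          then have N: "0 < ?N \<tau> w" using hnorm_horizontal_normal_eq_0_iff[of ?s w] hnorm_nonneg[of "horizontal_normal ?s w"] by linarith
          have "rho0 \<Phi> U J (?s w) powr (4/3) * ?N \<tau> w powr (4/3) = (rho0 \<Phi> U J (?s w) * ?N \<tau> w) powr (4/3)"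
            using rho0(2) by (simp add: powr_mult)
          also have "rho0 \<Phi> U J (?s w) * ?N \<tau> w = 1 / u"
            using rho0_leaf[OF inj w \<tau>] False N by (simp add: u_def)
          also have "(1 / u) powr (4/3) = u powr (- 4/3)"
            using u by (simp add: powr_divide powr_minus_divide)
          finally show ?thesis unfolding hw by (simp add: mult.assoc)
        qed
      qed
      then show "ennreal (h (\<Phi> (w, \<tau>)) * ?N \<tau> w powr (4/3)) * indicator U w
          \<le> ennreal (k \<tau> powr (2/3) * u powr (- 4/3)) * indicator U w"
        by (auto simp: indicator_def intro!: ennreal_leI)
    qed
    also have "\<dots> = ennreal (k \<tau> powr (2/3) * u powr (- 4/3)) * ennreal u"
      using U(1) by (simp add: nn_integral_cmult_indicator eu)
    also have "\<dots> = ennreal (k \<tau> powr (2/3)) * ennreal (u powr (- 1/3))"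
    proof -
      have "u powr (- 4/3) * u = u powr (- 1/3)" using u powr_add[of u "- 4/3" 1] by simp
      then show ?thesis using u by (simp add: ennreal_mult[symmetric] mult.assoc)
    qed
    also have "\<dots> \<le> ennreal (k \<tau> powr (2/3)) * (\<integral>\<^sup>+w\<in>U. ennreal (\<phi> w powr (4/3)) \<partial>lborel)"
      using H by (intro mult_left_mono) auto
    also have "\<dots> = (\<integral>\<^sup>+w\<in>U. ennreal (k \<tau> powr (2/3) * \<phi> w powr (4/3)) \<partial>lborel)"
      using \<phi>m U(1) by (subst nn_integral_cmult[symmetric]) (auto simp: ennreal_mult mult_ac)
    also have "\<dots> = (\<integral>\<^sup>+w\<in>U. ennreal (g (\<Phi> (w, \<tau>)) * ?N \<tau> w powr (4/3)) \<partial>lborel)"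
    proof (rule nn_integral_cong)
      fix w
      have "k \<tau> powr (2/3) * \<phi> w powr (4/3) = g (\<Phi> (w, \<tau>)) * ?N \<tau> w powr (4/3)" if w: "w \<in> U"
      proof -
        have q: "?s w \<in> \<Omega>" by (rule in\<Omega>[OF \<tau> w])
        have "\<phi> w = \<rho> (f (?s w)) * (area_stretch f (?s w) * ?N \<tau> w)"
          using w N'[OF w] by (simp add: \<phi>_def)
        then have "\<phi> w powr (4/3) = \<rho> (f (?s w)) powr (4/3) * (area_stretch f (?s w) powr (4/3) * ?N \<tau> w powr (4/3))"
          using r0 area_stretch_pos[OF f q] by (simp add: powr_mult)
        then have "k \<tau> powr (2/3) * \<phi> w powr (4/3)
            = (distortion f (?s w) powr (2/3) * area_stretch f (?s w) powr (4/3)) * \<rho> (f (?s w)) powr (4/3) * ?N \<tau> w powr (4/3)"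
          by (simp add: k[OF \<tau> w] mult_ac)
        then show ?thesis
          unfolding distortion_powr_area_stretch[OF f q] by (simp add: g_def leaf_def)
      qed
      then show "ennreal (k \<tau> powr (2/3) * \<phi> w powr (4/3)) * indicator U w
          = ennreal (g (\<Phi> (w, \<tau>)) * ?N \<tau> w powr (4/3)) * indicator U w"
        by (auto simp: indicator_def)
    qed
    finally show "(\<integral>\<^sup>+w\<in>U. ennreal (h (\<Phi> (w, \<tau>)) * ?N \<tau> w powr (4/3)) \<partial>lborel)
        \<le> (\<integral>\<^sup>+w\<in>U. ennreal (g (\<Phi> (w, \<tau>)) * ?N \<tau> w powr (4/3)) \<partial>lborel)" .
  qed
  also have "\<dots> = (\<integral>\<^sup>+p\<in>\<Omega>. ennreal (g p) \<partial>lborel)"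
    by (rule dis[OF gm, symmetric]) (simp add: g_def)
  also have "\<dots> = (\<integral>\<^sup>+q\<in>\<Omega>'. ennreal (\<rho> q powr (4/3)) \<partial>lborel)"
    unfolding g_def using rb by (intro nn_integral_contact_change_of_variables[OF f, symmetric]) auto
  also have "\<dots> \<le> (\<integral>\<^sup>+q. ennreal (\<rho> q powr (4/3)) \<partial>lborel)"
    by (intro nn_integral_mono) (auto simp: indicator_def)
  finally show "(\<integral>\<^sup>+p\<in>\<Omega>. ennreal (distortion f p powr (2/3) * rho0 \<Phi> U J p powr (4/3)) \<partial>lborel)
      \<le> (\<integral>\<^sup>+q. ennreal (\<rho> q powr (4/3)) \<partial>lborel)"
    unfolding h_def .
qed

theorem theorem1p4:
  fixes \<Omega> \<Omega>' :: "heis set" and U :: "(real^2) set" and J :: "real set"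
    and \<Phi> :: "(real^2) \<times> real \<Rightarrow> heis" and f\<^sub>0 :: "heis \<Rightarrow> heis" and \<Sigma> :: "heis set set"
  assumes "domain \<Omega>" and "domain \<Omega>'"
    and "open J" and "open U" and "0 < emeasure lborel U" and "emeasure lborel U < \<infinity>"
    and "diffeo_on \<Phi> (U \<times> J) \<Omega>"
    and "\<forall>\<tau>\<in>J. regular_patch (leaf \<Phi> \<tau>) U"
    and "\<forall>\<tau>\<in>J. AE w in lborel. w \<in> U \<longrightarrow> horizontal_normal (leaf \<Phi> \<tau>) w \<noteq> 0"
    and "\<exists>\<mu>. volume_disintegration \<Phi> U J \<Omega> \<mu>"
    and "C2_contact_qc f\<^sub>0 \<Omega> \<Omega>'"
    and "\<forall>S\<in>leaves \<Phi> U J. minimal_stretching f\<^sub>0 S"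
    and "\<exists>k :: real \<Rightarrow> real. \<forall>\<tau>\<in>J. \<forall>w\<in>U. distortion f\<^sub>0 (leaf \<Phi> \<tau> w) = k \<tau>"
    and "leaves \<Phi> U J \<subseteq> \<Sigma>" and "\<forall>S\<in>\<Sigma>. regular_surface S \<and> S \<subseteq> \<Omega>"
    and "rho0 \<Phi> U J \<in> Adm \<Sigma>"
    and "0 < (\<integral>\<^sup>+p\<in>\<Omega>. ennreal (rho0 \<Phi> U J p powr (4/3)) \<partial>lborel)"
    and "(\<integral>\<^sup>+p\<in>\<Omega>. ennreal (rho0 \<Phi> U J p powr (4/3)) \<partial>lborel) < \<infinity>"
  shows "\<forall>f. C2_contact_qc f \<Omega> \<Omega>' \<and>
           Modulus (image_family f\<^sub>0 (leaves \<Phi> U J)) \<le> Modulus (image_family f \<Sigma>) \<longrightarrow>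
           mean_distortion \<Omega> f\<^sub>0 (rho0 \<Phi> U J) \<le> mean_distortion \<Omega> f (rho0 \<Phi> U J)"
proof (intro allI impI, elim conjE)
  fix f :: "heis \<Rightarrow> heis"
  assume f: "C2_contact_qc f \<Omega> \<Omega>'"
    and Mod: "Modulus (image_family f\<^sub>0 (leaves \<Phi> U J)) \<le> Modulus (image_family f \<Sigma>)"
  let ?\<rho> = "rho0 \<Phi> U J"
  let ?I = "\<lambda>f. \<integral>\<^sup>+p\<in>\<Omega>. ennreal (distortion f p powr (2/3) * ?\<rho> p powr (4/3)) \<partial>lborel"
  obtain \<mu> where \<mu>: "volume_disintegration \<Phi> U J \<Omega> \<mu>" using assms(10) ..
  obtain k :: "real \<Rightarrow> real" where k: "\<And>\<tau> w. \<tau> \<in> J \<Longrightarrow> w \<in> U \<Longrightarrow> distortion f\<^sub>0 (leaf \<Phi> \<tau> w) = k \<tau>"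
    using assms(13) by auto
  have rho: "?\<rho> \<in> borel_measurable borel" "\<And>p. 0 \<le> ?\<rho> p"
    using assms(16) unfolding Adm_def by auto
  have "?I f\<^sub>0 \<le> Modulus (image_family f\<^sub>0 (leaves \<Phi> U J))"
    by (rule Modulus_image_leaves_ge[OF assms(4,5,6,7) _ \<mu> assms(11) _ k rho])
       (use assms(8,12) in auto)
  also have "\<dots> \<le> Modulus (image_family f \<Sigma>)" by (rule Mod)
  also have "\<dots> \<le> ?I f"
    by (rule Modulus_image_le[OF f assms(16)])
       (use assms(15) in \<open>auto simp: regular_surface_def covered_by_patches_def\<close>)
  finally show "mean_distortion \<Omega> f\<^sub>0 ?\<rho> \<le> mean_distortion \<Omega> f ?\<rho>"
    unfolding mean_distortion_def by (rule divide_right_mono_ennreal)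
qed

end
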